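(* Let $H$ be a real separable Hilbert space and let $A_1,\dots,A_N$ be independent random self-adjoint operators on $H$ satisfying $0\preceq A_k\preceq I$, and suppose that for some integer $d\ge1$ $$\dim\mathrm{Span}\big(\mathrm{Ran}(A_1),\dots,\mathrm{Ran}(A_N)\big)\le d$$ almost surely. Then: (i) for all $s>0$, $$\Pr\left\{\Big\|\sum_k(A_k-\mathbb{E}A_k)\Big\|_\infty>s\right\}\le4d^2\exp\left(\frac{-s^2}{9\left\|\sum_k\mathbb{E}A_k\right\|_\infty+6s}\right);$$ (ii) for all $s\ge0$ and all conjugate exponents $p,q$, $$\Pr\left\{\Big\|\sum_kA_k\Big\|_\infty>p\,\Big\|\mathbb{E}\sum_kA_k\Big\|_\infty+s\right\}\le4d^2e^{-s/(6q)};$$ (iii) $$\sqrt{\mathbb{E}\Big\|\sum_kA_k\Big\|_\infty}\le\sqrt{\Big\|\mathbb{E}\sum_kA_k\Big\|_\infty}+\sqrt{6\left(\ln(4d^2)+1\right)}.$$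
   Context: $\mathrm{Ran}(A)$ is the range of $A$; $\|\cdot\|_\infty$ is the operator norm; $I$ is the identity on $H$; $A\preceq B$ means that $B-A$ is a nonnegative operator, i.e. self-adjoint with $\langle(B-A)x,x\rangle\ge0$ for all $x\in H$. The span in the dimension condition is the random subspace spanned by the ranges of a single random realization of $A_1,\dots,A_N$; it need not be contained in any fixed finite dimensional subspace. Conjugate exponents are real numbers $p,q>1$ with $1/p+1/q=1$. *)

theory Defs
  imports "HOL-Analysis.Analysis" "HOL-Probability.Probability"
begin

definition self_adjoint :: "('a::real_inner \<Rightarrow>\<^sub>L 'a) \<Rightarrow> bool" where
  "self_adjoint T \<longleftrightarrow> (\<forall>x y. blinfun_apply T x \<bullet> y = x \<bullet> blinfun_apply T y)"

definition nonneg_op :: "('a::real_inner \<Rightarrow>\<^sub>L 'a) \<Rightarrow> bool" where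
  "nonneg_op T \<longleftrightarrow> self_adjoint T \<and> (\<forall>x. blinfun_apply T x \<bullet> x \<ge> 0)"

definition op_le :: "('a::real_inner \<Rightarrow>\<^sub>L 'a) \<Rightarrow> ('a \<Rightarrow>\<^sub>L 'a) \<Rightarrow> bool" (infix "\<preceq>" 50) where
  "A \<preceq> B \<longleftrightarrow> nonneg_op (B - A)"

text \<open>
  The library's \<^const>\<open>dim\<close> is \<open>0\<close> on infinite-dimensional spaces, so the existence of a
  finite spanning set has to be required separately.
\<close>
definition finite_dim_le :: "'a::real_vector set \<Rightarrow> nat \<Rightarrow> bool" where
  "finite_dim_le V d \<longleftrightarrow> (\<exists>B. finite B \<and> V \<subseteq> span B) \<and> dim V \<le> d"

text \<open>
  The smallest \<open>\<sigma>\<close>-algebra on bounded operators making all evaluations \<open>T \<mapsto> T x\<close> measurable.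
  The space of operators is in general not separable in the operator norm, so its norm-Borel
  \<open>\<sigma>\<close>-algebra is too large for sums of random operators to be measurable. The norm-Borel
  \<open>\<sigma>\<close>-algebra contains this one (so norm-Borel random operators are covered), the operator
  norm is measurable for it over a separable domain, and the two induce the same sets on every
  norm-separable set of operators on a separable Hilbert space, e.g. the compact ones.
\<close>
definition operator_algebra :: "('a::real_normed_vector \<Rightarrow>\<^sub>L 'b::real_normed_vector) measure" where
  "operator_algebra = vimage_algebra UNIV blinfun_apply (Pi\<^sub>M UNIV (\<lambda>_. borel))"

text \<open>
  The expectation is the operator \<open>x \<mapsto> \<E>[X x]\<close>, a Bochner integral in the target space; it is
  meaningful whenever this map is bounded linear, in particular for almost surely bounded
  random operators (lemma \<open>op_expectation_apply\<close>).
\<close>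
definition op_expectation ::
  "'w measure \<Rightarrow> ('w \<Rightarrow> ('a::real_normed_vector \<Rightarrow>\<^sub>L 'b::{banach, second_countable_topology})) \<Rightarrow> ('a \<Rightarrow>\<^sub>L 'b)"
where
  "op_expectation M X = Blinfun (\<lambda>x. integral\<^sup>L M (\<lambda>\<omega>. blinfun_apply (X \<omega>) x))"

lemma space_operator_algebra [simp]: "space operator_algebra = UNIV"
  by (simp add: operator_algebra_def)

lemma measurable_operator_eval [measurable]:
  "(\<lambda>T. blinfun_apply T x) \<in> operator_algebra \<rightarrow>\<^sub>M borel"
proof -
  have "blinfun_apply \<in> operator_algebra \<rightarrow>\<^sub>M Pi\<^sub>M UNIV (\<lambda>_. borel)"
    unfolding operator_algebra_def by (rule measurable_vimage_algebra1) (simp add: space_PiM)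
  then show ?thesis
    by (rule measurable_compose) (rule measurable_component_singleton, simp)
qed

lemma measurable_operator_algebraI:
  assumes "\<And>x. (\<lambda>\<omega>. blinfun_apply (X \<omega>) x) \<in> M \<rightarrow>\<^sub>M borel"
  shows "X \<in> M \<rightarrow>\<^sub>M operator_algebra"
  unfolding operator_algebra_def
  by (rule measurable_vimage_algebra2) (auto intro!: measurable_PiM_single' assms)

lemma sets_operator_algebra_subset_borel:
  "sets (operator_algebra :: ('a::real_normed_vector \<Rightarrow>\<^sub>L 'b::real_normed_vector) measure) \<subseteq> sets borel"
proof -
  have "(\<lambda>T. T) \<in> borel \<rightarrow>\<^sub>M (operator_algebra :: ('a \<Rightarrow>\<^sub>L 'b) measure)"
    by (rule measurable_operator_algebraI)
      (intro borel_measurable_continuous_onI continuous_intros)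
  then show ?thesis
    by (auto dest: measurable_sets)
qed

lemma measurable_operator_norm [measurable]:
  "(norm :: ('a::{real_normed_vector, second_countable_topology}
      \<Rightarrow>\<^sub>L 'b::{real_normed_vector, second_countable_topology}) \<Rightarrow> real)
     \<in> operator_algebra \<rightarrow>\<^sub>M borel"
proof (rule borel_measurableI_le)
  fix c :: real
  obtain D :: "'a set" where D: "countable D"
    and dense: "\<And>X. open X \<Longrightarrow> X \<noteq> {} \<Longrightarrow> \<exists>d\<in>D. d \<in> X"
    using countable_dense_setE by blast
  have clD: "closure D = UNIV"
  proof (rule ccontr)
    assume "closure D \<noteq> UNIV"
    then have "- closure D \<noteq> {}" by auto
    with dense[of "- closure D"] obtain d where "d \<in> D" "d \<in> - closure D"
      by (auto simp: open_Compl)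
    with closure_subset[of D] show False by auto
  qed
  have eq: "{T :: 'a \<Rightarrow>\<^sub>L 'b. norm T \<le> c} = {T. \<forall>x\<in>D. norm (blinfun_apply T x) \<le> c * norm x}"
    if "c \<ge> 0"
  proof (intro Collect_cong iffI ballI)
    fix T :: "'a \<Rightarrow>\<^sub>L 'b" and x
    assume "norm T \<le> c"
    then show "norm (blinfun_apply T x) \<le> c * norm x"
      by (meson mult_right_mono norm_blinfun norm_ge_zero order_trans)
  next
    fix T :: "'a \<Rightarrow>\<^sub>L 'b"
    assume *: "\<forall>x\<in>D. norm (blinfun_apply T x) \<le> c * norm x"
    have "closed {x. norm (blinfun_apply T x) \<le> c * norm x}"
      by (intro closed_Collect_le continuous_intros)
    with * have "closure D \<subseteq> {x. norm (blinfun_apply T x) \<le> c * norm x}"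
      by (intro closure_minimal) auto
    with clD that show "norm T \<le> c"
      by (intro norm_blinfun_bound) auto
  qed
  have "{T :: 'a \<Rightarrow>\<^sub>L 'b. norm T \<le> c} \<in> sets operator_algebra"
  proof (cases "c \<ge> 0")
    case True
    have "{T \<in> space operator_algebra. \<forall>x\<in>D. norm (blinfun_apply (T :: 'a \<Rightarrow>\<^sub>L 'b) x) \<le> c * norm x}
        \<in> sets operator_algebra"
      using D by measurable
    then show ?thesis by (simp add: eq[OF True])
  next
    case False
    then have "{T :: 'a \<Rightarrow>\<^sub>L 'b. norm T \<le> c} = {}"
      by (auto dest: order_trans[OF norm_ge_zero])
    then show ?thesis by simp
  qed
  then show "{T \<in> space operator_algebra. norm (T :: 'a \<Rightarrow>\<^sub>L 'b) \<le> c} \<in> sets operator_algebra"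
    by simp
qed

lemma op_expectation_apply:
  fixes X :: "'w \<Rightarrow> ('a::real_normed_vector \<Rightarrow>\<^sub>L 'b::{banach, second_countable_topology})"
  assumes "finite_measure M" "X \<in> M \<rightarrow>\<^sub>M operator_algebra" "AE \<omega> in M. norm (X \<omega>) \<le> C"
  shows "blinfun_apply (op_expectation M X) x = (\<integral>\<omega>. blinfun_apply (X \<omega>) x \<partial>M)"
proof -
  interpret finite_measure M by fact
  have ae: "AE \<omega> in M. norm (blinfun_apply (X \<omega>) x) \<le> C * norm x" for x
    using assms(3)
  proof eventually_elim
    fix \<omega> assume "norm (X \<omega>) \<le> C"
    then show "norm (blinfun_apply (X \<omega>) x) \<le> C * norm x"
      by (meson mult_right_mono norm_blinfun norm_ge_zero order_trans)
  qed
  have meas: "(\<lambda>\<omega>. blinfun_apply (X \<omega>) x) \<in> borel_measurable M" for x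
    using assms(2) by measurable
  have int: "integrable M (\<lambda>\<omega>. blinfun_apply (X \<omega>) x)" for x
    by (rule integrable_const_bound[OF ae meas])
  have "bounded_linear (\<lambda>x. \<integral>\<omega>. blinfun_apply (X \<omega>) x \<partial>M)"
  proof (rule bounded_linear_intro[where K = "C * measure M (space M)"])
    fix x
    have "norm (\<integral>\<omega>. blinfun_apply (X \<omega>) x \<partial>M) \<le> (\<integral>\<omega>. norm (blinfun_apply (X \<omega>) x) \<partial>M)"
      by (rule integral_norm_bound)
    also have "\<dots> \<le> (\<integral>\<omega>. C * norm x \<partial>M)"
      using ae int by (intro integral_mono_AE) auto
    finally show "norm (\<integral>\<omega>. blinfun_apply (X \<omega>) x \<partial>M) \<le> norm x * (C * measure M (space M))"
      by (simp add: mult_ac)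
  qed (simp_all add: blinfun.add_right blinfun.scaleR_right int)
  then show ?thesis
    by (simp add: op_expectation_def bounded_linear_Blinfun_apply)
qed

end

theory Submission
  imports Defs
begin

text \<open>
  Symmetrization with independent signs bounds \<open>U(t) = \<E> exp(t\<parallel>\<Sum>(A\<^sub>k - \<E>A\<^sub>k)\<parallel>)\<close> by
  \<open>\<E> exp(2t\<parallel>\<Sum>\<epsilon>\<^sub>kA\<^sub>k\<parallel>)\<close>. For a fixed realization all operators act on a space of dimension at
  most \<open>d\<close>, and the average over the signs is at most \<open>2d exp(2t\<^sup>2\<parallel>\<Sum>A\<^sub>k\<^sup>2\<parallel>)\<close>, where
  \<open>A\<^sub>k\<^sup>2 \<preceq> A\<^sub>k\<close>. This is obtained without the Golden-Thompson inequality from the trace moments: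
  with \<open>X = \<Sum>\<epsilon>\<^sub>kA\<^sub>k\<close>, exchanging the sign \<open>\<epsilon>\<^sub>k\<close> in \<open>tr(\<epsilon>\<^sub>kA\<^sub>kX\<^bsup>2r+1\<^esup>)\<close> and an arithmetic-geometric mean
  inequality for traces give \<open>\<E> tr X\<^bsup>2r+2\<^esup> \<le> (2r + 1) \<parallel>\<Sum>A\<^sub>k\<parallel> \<E> tr X\<^bsup>2r\<^esup>\<close>, and the resulting bounds
  \<open>(2r - 1)!! d \<parallel>\<Sum>A\<^sub>k\<parallel>\<^sup>r\<close> are summed in the power series of \<open>cosh\<close>. Since \<open>\<parallel>\<Sum>A\<^sub>k\<parallel>\<close> is
  at most \<open>V = \<parallel>\<Sum>\<E>A\<^sub>k\<parallel>\<close> plus the centred norm, \<open>U(t) \<le> 2d exp(2t\<^sup>2V) U(t)\<^bsup>2t\<^esup>\<close>, which is solved for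
  \<open>U(t)\<close> when \<open>t \<le> 1/4\<close>. The three claims follow by optimizing over \<open>t\<close>.
\<close>

section \<open>Orthonormal systems and powers of self-adjoint maps\<close>

text \<open>Gram-Schmidt, one vector at a time: the component \<open>u\<close> of the new vector
  orthogonal to the system is normalized and added unless it vanishes, so the cardinality never
  exceeds that of \<open>C\<close>.\<close>

lemma orthonormal_spanning_set_exists:
  fixes C :: "'a::real_inner set"
  assumes "finite C"
  obtains B where "finite B" "pairwise orthogonal B" "\<And>e. e \<in> B \<Longrightarrow> norm e = 1"
    "card B \<le> card C" "C \<subseteq> span B"
  using assms
proof (induction C arbitrary: thesis)
  case empty
  show ?case by (rule empty[of "{}"]) auto
next
  case (insert a C)
  obtain B where B: "finite B" "pairwise orthogonal B" "\<And>e. e \<in> B \<Longrightarrow> norm e = 1"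
    "card B \<le> card C" "C \<subseteq> span B"
    using insert.IH by blast
  define w where "w = (\<Sum>e\<in>B. (a \<bullet> e) *\<^sub>R e)"
  define u where "u = a - w"
  have w: "w \<in> span B"
    unfolding w_def by (intro span_sum span_scale span_base)
  have orth: "u \<bullet> e = 0" if e: "e \<in> B" for e
  proof -
    have "w \<bullet> e = (\<Sum>f\<in>B. if f = e then a \<bullet> e else 0)"
      unfolding w_def inner_sum_left
      using B(2,3) e by (intro sum.cong) (auto simp: pairwise_def orthogonal_def dot_square_norm)
    also have "\<dots> = a \<bullet> e"
      using B(1) e by simp
    finally show ?thesis
      by (simp add: u_def inner_diff_left)
  qed
  show ?case
  proof (cases "u = 0")
    case True
    then have "a \<in> span B" using w by (simp add: u_def)
    with B insert.hyps show ?thesis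
      by (intro insert.prems[of B]) auto
  next
    case False
    let ?u = "u /\<^sub>R norm u"
    show ?thesis
    proof (rule insert.prems[of "insert ?u B"])
      show "pairwise orthogonal (insert ?u B)"
        using B(2) orth by (auto simp: pairwise_insert orthogonal_def inner_commute)
      show "card (insert ?u B) \<le> card (insert a C)"
        using B insert.hyps by (simp add: card_insert_if)
      have "a = norm u *\<^sub>R ?u + w"
        using False by (simp add: u_def)
      also have "\<dots> \<in> span (insert ?u B)"
        by (rule span_add[OF span_scale[OF span_base]])
          (use w span_mono[of B "insert ?u B"] in auto)
      finally show "insert a C \<subseteq> span (insert ?u B)"
        using B(5) span_mono[of B "insert ?u B"] by auto
    qed (use B False in auto)
  qed
qed

lemma linear_funpow:
  fixes f :: "'a::real_vector \<Rightarrow> 'a"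
  assumes "linear f"
  shows "linear (f ^^ n)"
proof (induction n)
  case (Suc n)
  from linear_compose[OF this assms] show ?case by (simp add: o_def)
qed (simp add: linear_iff)

lemma self_adjoint_funpow:
  fixes f :: "'a::real_inner \<Rightarrow> 'a"
  assumes "\<And>x y. f x \<bullet> y = x \<bullet> f y"
  shows "(f ^^ n) x \<bullet> y = x \<bullet> (f ^^ n) y"
  by (induction n arbitrary: x y) (simp_all add: assms funpow_swap1)

text \<open>By self-adjointness and Cauchy-Schwarz the norms \<open>a n\<close> of the iterates are
  log-convex. Their successive ratios therefore never drop below the first one, which is
  \<open>a 1\<close>.\<close>

lemma norm_power_le_norm_funpow:
  fixes f :: "'a::real_inner \<Rightarrow> 'a"
  assumes sa: "\<And>x y. f x \<bullet> y = x \<bullet> f y" and x: "norm x = 1"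
  shows "norm (f x) ^ n \<le> norm ((f ^^ n) x)"
proof -
  define a where "a n = norm ((f ^^ n) x)" for n
  have a0: "a 0 = 1" and nonneg: "a n \<ge> 0" for n
    using x by (simp_all add: a_def)
  have log_convex: "(a (Suc n))\<^sup>2 \<le> a n * a (Suc (Suc n))" for n
  proof -
    have "(a (Suc n))\<^sup>2 = f ((f ^^ n) x) \<bullet> f ((f ^^ n) x)"
      by (simp add: a_def power2_norm_eq_inner)
    also have "\<dots> = (f ^^ n) x \<bullet> (f ^^ Suc (Suc n)) x"
      by (simp add: sa)
    also have "\<dots> \<le> a n * a (Suc (Suc n))"
      unfolding a_def by (rule norm_cauchy_schwarz)
    finally show ?thesis .
  qed
  have step: "a 1 * a n \<le> a (Suc n)" for n
  proof (induction n)
    case 0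
    then show ?case by (simp add: a0)
  next
    case (Suc n)
    show ?case
    proof (cases "a (Suc n) = 0")
      case True
      then show ?thesis using nonneg by simp
    next
      case False
      then have pos: "a (Suc n) > 0" using nonneg[of "Suc n"] by simp
      \<comment> \<open>Log-convexity excludes a zero before a nonzero iterate, so
        \<open>a n\<close> may be cancelled below.\<close>
      have "a n > 0" using log_convex[of n] pos nonneg[of n] by (cases "a n = 0") auto
      have "a 1 * a n * a (Suc n) \<le> a (Suc n) * a (Suc n)"
        using Suc pos by (intro mult_right_mono) auto
      also have "\<dots> \<le> a n * a (Suc (Suc n))"
        using log_convex[of n] by (simp add: power2_eq_square)
      finally have "a n * (a 1 * a (Suc n)) \<le> a n * a (Suc (Suc n))"
        by (simp add: mult_ac)
      with \<open>a n > 0\<close> show ?thesis by simp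
    qed
  qed
  have "a 1 ^ n \<le> a n"
  proof (induction n)
    case (Suc n)
    have "a 1 ^ Suc n \<le> a 1 * a n"
      using Suc nonneg[of 1] by (simp add: mult_left_mono)
    with step[of n] show ?case by linarith
  qed (simp add: a0)
  then show ?thesis by (simp add: a_def)
qed

section \<open>Traces of powers\<close>

text \<open>The traces below are taken in an orthonormal basis of a finite-dimensional invariant subspace,
  as the ambient space may be infinite-dimensional.\<close>

locale orthonormal_system =
  fixes B :: "'a::real_inner set"
  assumes finite_basis: "finite B"
    and pairwise_orthogonal: "pairwise orthogonal B"
    and norm_basis: "\<And>e. e \<in> B \<Longrightarrow> norm e = 1"
begin

definition trace :: "('a \<Rightarrow> 'a) \<Rightarrow> real" where
  "trace f = (\<Sum>e\<in>B. f e \<bullet> e)"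

definition hs_norm2 :: "('a \<Rightarrow> 'a) \<Rightarrow> real" where
  "hs_norm2 f = (\<Sum>e\<in>B. (norm (f e))\<^sup>2)"

lemma hs_norm2_nonneg: "hs_norm2 f \<ge> 0"
  by (simp add: hs_norm2_def sum_nonneg)

text \<open>Both traces expand into the same double sum of products of matrix entries. The maps have
  to send \<open>B\<close> into its span, since otherwise the expansion in \<open>B\<close> would
  lose components.\<close>

lemma trace_cyclic:
  assumes f: "linear f" "\<And>e. e \<in> B \<Longrightarrow> f e \<in> span B"
    and g: "linear g" "\<And>e. e \<in> B \<Longrightarrow> g e \<in> span B"
  shows "trace (\<lambda>x. f (g x)) = trace (\<lambda>x. g (f x))"
proof -
  have expand: "trace (\<lambda>x. f (g x)) = (\<Sum>e\<in>B. \<Sum>i\<in>B. (g e \<bullet> i) * (f i \<bullet> e))"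
    if "linear f" "\<And>e. e \<in> B \<Longrightarrow> g e \<in> span B" for f g
  proof -
    have "f (g e) \<bullet> e = (\<Sum>i\<in>B. (g e \<bullet> i) * (f i \<bullet> e))" if e: "e \<in> B" for e
    proof -
      have "f (g e) = f (\<Sum>i\<in>B. (g e \<bullet> i) *\<^sub>R i)"
        using orthonormal_basis_expand[OF pairwise_orthogonal norm_basis _ finite_basis, of "g e"]
          \<open>\<And>e. e \<in> B \<Longrightarrow> g e \<in> span B\<close>[OF e] by simp
      also have "\<dots> = (\<Sum>i\<in>B. (g e \<bullet> i) *\<^sub>R f i)"
        using \<open>linear f\<close> by (simp add: linear_sum linear_scale)
      finally show ?thesis by (simp add: inner_sum_left)
    qed
    then show ?thesis by (simp add: trace_def)
  qed
  have "trace (\<lambda>x. f (g x)) = (\<Sum>e\<in>B. \<Sum>i\<in>B. (g e \<bullet> i) * (f i \<bullet> e))"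
    by (rule expand) (use f g in auto)
  also have "\<dots> = (\<Sum>e\<in>B. \<Sum>i\<in>B. (f e \<bullet> i) * (g i \<bullet> e))"
    by (subst sum.swap) (simp add: mult.commute)
  also have "\<dots> = trace (\<lambda>x. g (f x))"
    by (rule expand[symmetric]) (use f g in auto)
  finally show ?thesis .
qed

lemma norm_le_hs_norm2:
  assumes "linear f" "x \<in> span B"
  shows "(norm (f x))\<^sup>2 \<le> hs_norm2 f * (norm x)\<^sup>2"
proof -
  have x: "(\<Sum>e\<in>B. (x \<bullet> e) *\<^sub>R e) = x"
    by (rule orthonormal_basis_expand[OF pairwise_orthogonal norm_basis assms(2) finite_basis])
  have "(norm x)\<^sup>2 = x \<bullet> (\<Sum>e\<in>B. (x \<bullet> e) *\<^sub>R e)"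
    by (simp add: x power2_norm_eq_inner)
  then have nx: "(norm x)\<^sup>2 = (\<Sum>e\<in>B. (x \<bullet> e)\<^sup>2)"
    by (simp add: inner_sum_right power2_eq_square)
  have "norm (f x) = norm (\<Sum>e\<in>B. (x \<bullet> e) *\<^sub>R f e)"
    by (subst x[symmetric]) (simp add: assms(1) linear_sum linear_scale)
  also have "\<dots> \<le> (\<Sum>e\<in>B. \<bar>x \<bullet> e\<bar> * norm (f e))"
    by (rule order_trans[OF norm_sum]) simp
  finally have "(norm (f x))\<^sup>2 \<le> (\<Sum>e\<in>B. \<bar>x \<bullet> e\<bar> * norm (f e))\<^sup>2"
    by (intro power_mono) auto
  also have "\<dots> \<le> (\<Sum>e\<in>B. \<bar>x \<bullet> e\<bar>\<^sup>2) * (\<Sum>e\<in>B. (norm (f e))\<^sup>2)"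
    by (rule Cauchy_Schwarz_ineq_sum)
  finally show ?thesis
    by (simp add: nx hs_norm2_def mult.commute)
qed

text \<open>Stands in for the spectral theorem: the Hilbert-Schmidt norm of \<open>f ^^ n\<close>
  dominates its norm on \<open>span B\<close>, and the iterates of a unit vector \<open>u\<close>
  have norm at least \<open>norm (f u) ^ n\<close>. No eigenvectors are involved.\<close>

lemma norm_power_le_hs_norm2_funpow:
  assumes lin: "linear f" and sa: "\<And>x y. f x \<bullet> y = x \<bullet> f y" and x: "x \<in> span B" and n: "n > 0"
  shows "norm (f x) ^ (2 * n) \<le> hs_norm2 (f ^^ n) * norm x ^ (2 * n)"
proof (cases "x = 0")
  case True
  with lin n show ?thesis by (simp add: linear_0 power_0_left)
next
  case False
  let ?u = "x /\<^sub>R norm x"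
  have u: "norm ?u = 1" "?u \<in> span B"
    using False x by (auto intro: span_scale)
  have "norm (f ?u) ^ (2 * n) = (norm (f ?u) ^ n)\<^sup>2"
    by (simp add: power_mult[symmetric] mult.commute)
  also have "\<dots> \<le> (norm ((f ^^ n) ?u))\<^sup>2"
    by (intro power_mono norm_power_le_norm_funpow sa u) auto
  also have "\<dots> \<le> hs_norm2 (f ^^ n)"
    using norm_le_hs_norm2[OF linear_funpow[OF lin] u(2), of n] by (simp add: u(1)[simplified])
  finally have "norm (f ?u) ^ (2 * n) \<le> hs_norm2 (f ^^ n)" .
  moreover have "norm (f x) = norm x * norm (f ?u)"
    using False lin by (simp add: linear_scale)
  ultimately show ?thesis
    by (simp add: power_mult_distrib mult.commute[of _ "norm x ^ _"] mult_left_mono)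
qed

lemma norm_blinfun_power_le_hs_norm2:
  assumes sa: "self_adjoint X" and range: "\<And>x. blinfun_apply X x \<in> span B" and n: "n > 0"
  shows "norm X ^ (2 * n) \<le> hs_norm2 (blinfun_apply X ^^ n)"
proof -
  let ?f = "blinfun_apply X"
  define c where "c = root (2 * n) (hs_norm2 (?f ^^ n))"
  have c0: "c \<ge> 0" by (simp add: c_def hs_norm2_nonneg real_root_ge_zero)
  have cpow: "c ^ (2 * n) = hs_norm2 (?f ^^ n)"
    unfolding c_def using n by (intro real_root_pow_pos2) (auto simp: hs_norm2_nonneg)
  have sa': "?f x \<bullet> y = x \<bullet> ?f y" for x y
    using sa by (simp add: self_adjoint_def)
  have lin: "linear ?f"
    by (simp add: blinfun.bounded_linear_right bounded_linear.linear)
  have on_span: "norm (?f y) \<le> c * norm y" if "y \<in> span B" for y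
  proof (rule power_le_imp_le_base)
    have "norm (?f y) ^ (2 * n) \<le> (c * norm y) ^ (2 * n)"
      using norm_power_le_hs_norm2_funpow[OF lin sa' that n]
      by (simp add: cpow power_mult_distrib)
    then show "norm (?f y) ^ Suc (2 * n - 1) \<le> (c * norm y) ^ Suc (2 * n - 1)"
      using n by simp
  qed (use c0 in simp)
  have "norm (?f x) \<le> c * norm x" for x
  proof (cases "?f x = 0")
    case False
    \<comment> \<open>For \<open>x\<close> outside \<open>span B\<close>: one application of
      \<open>X\<close> lands in the span, where the bound is known, and self-adjointness transfers
      it back to \<open>x\<close>.\<close>
    have "norm (?f x) * norm (?f x) = x \<bullet> ?f (?f x)"
      by (simp add: sa'[symmetric] dot_square_norm power2_eq_square)
    also have "\<dots> \<le> norm x * norm (?f (?f x))"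
      by (rule norm_cauchy_schwarz)
    also have "\<dots> \<le> norm x * (c * norm (?f x))"
      by (intro mult_left_mono on_span range) auto
    finally show ?thesis using False by (simp add: mult_ac)
  qed (use c0 in simp)
  then have "norm X \<le> c"
    by (intro norm_blinfun_bound c0)
  then show ?thesis
    by (metis cpow norm_ge_zero power_mono)
qed

text \<open>Expanding \<open>\<parallel>W\<^sup>a H Y\<^sup>r\<^sup>-\<^sup>a - W\<^sup>c H Y\<^sup>r\<^sup>-\<^sup>c\<parallel>\<^sup>2 \<ge> 0\<close> in the Hilbert-Schmidt norm gives
  \<open>2 f(a + c) \<le> f(2a) + f(2c)\<close> for the traces \<open>f(q) = tr(H W\<^sup>q H Y\<^sup>2\<^sup>r\<^sup>-\<^sup>q)\<close>, so that
  \<open>h(q) = f(q) + f(2r - q)\<close> satisfies \<open>2 h(q) \<le> h(0) + max h\<close>, hence \<open>max h \<le> h(0)\<close>.\<close>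

lemma trace_mixed_power_sum_le:
  assumes lin: "linear H" "linear W" "linear Y"
    and sa: "\<And>x y. H x \<bullet> y = x \<bullet> H y" "\<And>x y. W x \<bullet> y = x \<bullet> W y" "\<And>x y. Y x \<bullet> y = x \<bullet> Y y"
    and inv: "\<And>x. x \<in> span B \<Longrightarrow> H x \<in> span B" "\<And>x. x \<in> span B \<Longrightarrow> W x \<in> span B"
      "\<And>x. x \<in> span B \<Longrightarrow> Y x \<in> span B"
  shows "2 * (\<Sum>q\<le>2*r. trace (\<lambda>x. H ((W ^^ q) (H ((Y ^^ (2*r-q)) x)))))
    \<le> (2 * real r + 1) * (hs_norm2 (\<lambda>x. H ((W ^^ r) x)) + hs_norm2 (\<lambda>x. H ((Y ^^ r) x)))"
proof -
  define f where "f q = trace (\<lambda>x. H ((W ^^ q) (H ((Y ^^ (2*r-q)) x))))" for q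
  define G where "G a x = (W ^^ a) (H ((Y ^^ (r-a)) x))" for a x
  note linp = lin linear_funpow[OF lin(2)] linear_funpow[OF lin(3)]
  have Wp: "x \<in> span B \<Longrightarrow> (W ^^ n) x \<in> span B" and Yp: "x \<in> span B \<Longrightarrow> (Y ^^ n) x \<in> span B" for n x
    by (induction n) (auto intro: inv)
  note invp = inv Wp Yp
  have lin_HW: "linear (\<lambda>x. H ((W ^^ n) x))" for n
    using linear_compose[OF linp(4)[of n] lin(1)] by (simp add: o_def)
  have lin_WH: "linear (\<lambda>x. (W ^^ n) (H x))" for n
    using linear_compose[OF lin(1) linp(4)[of n]] by (simp add: o_def)
  have lin_HY: "linear (\<lambda>x. H ((Y ^^ n) x))" for n
    using linear_compose[OF linp(5)[of n] lin(1)] by (simp add: o_def)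
  have lin_HWHY: "linear (\<lambda>x. H ((W ^^ m) (H ((Y ^^ n) x))))" for m n
    using linear_compose[OF lin_HY[of n] lin_HW[of m]] by (simp add: o_def)
  have fG: "(\<Sum>e\<in>B. G a e \<bullet> G c e) = f (a + c)" if "a \<le> r" "c \<le> r" for a c
  proof -
    have "G a e \<bullet> G c e = (Y ^^ (r-c)) (H ((W ^^ (a+c)) (H ((Y ^^ (r-a)) e)))) \<bullet> e" for e
    proof -
      have "G a e \<bullet> G c e = (W ^^ c) (G a e) \<bullet> H ((Y ^^ (r-c)) e)"
        by (simp add: G_def[of c] self_adjoint_funpow[OF sa(2)])
      also have "\<dots> = (Y ^^ (r-c)) (H ((W ^^ c) (G a e))) \<bullet> e"
        by (simp add: sa(1) self_adjoint_funpow[OF sa(3)])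
      also have "(W ^^ c) (G a e) = (W ^^ (a+c)) (H ((Y ^^ (r-a)) e))"
        by (simp add: G_def funpow_add add.commute[of a c])
      finally show ?thesis .
    qed
    then have "(\<Sum>e\<in>B. G a e \<bullet> G c e)
        = trace (\<lambda>x. (Y ^^ (r-c)) (H ((W ^^ (a+c)) (H ((Y ^^ (r-a)) x)))))"
      by (simp add: trace_def)
    also have "\<dots> = trace (\<lambda>x. H ((W ^^ (a+c)) (H ((Y ^^ (r-a)) ((Y ^^ (r-c)) x)))))"
      by (rule trace_cyclic[of "Y ^^ (r-c)" "\<lambda>x. H ((W ^^ (a+c)) (H ((Y ^^ (r-a)) x)))"])
        (auto intro: lin_HWHY linp invp(5) simp: invp span_base)
    also have "\<dots> = f (a + c)"
    proof -
      have "r - a + (r - c) = 2*r - (a+c)" using that by simp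
      then have "(Y ^^ (r-a)) ((Y ^^ (r-c)) x) = (Y ^^ (2*r-(a+c))) x" for x
        by (metis comp_apply funpow_add)
      then show ?thesis by (simp add: f_def)
    qed
    finally show ?thesis .
  qed
  have amgm: "2 * f (a + c) \<le> f (2*a) + f (2*c)" if "a \<le> r" "c \<le> r" for a c
  proof -
    have "0 \<le> (\<Sum>e\<in>B. (G a e - G c e) \<bullet> (G a e - G c e))"
      by (intro sum_nonneg) simp
    also have "\<dots> = (\<Sum>e\<in>B. G a e \<bullet> G a e) + (\<Sum>e\<in>B. G c e \<bullet> G c e) - 2 * (\<Sum>e\<in>B. G a e \<bullet> G c e)"
    proof -
      have "(x - y) \<bullet> (x - y) = x \<bullet> x + y \<bullet> y - 2 * (x \<bullet> y)" for x y :: 'a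
        using inner_commute[of x y] by (simp add: inner_diff_left inner_diff_right)
      then show ?thesis
        by (simp add: sum.distrib sum_subtractf sum_distrib_left)
    qed
    finally show ?thesis
      using fG[of a a] fG[of c c] fG[of a c] that by (simp flip: mult_2)
  qed
  define h where "h q = f q + f (2*r-q)" for q
  have h_sym: "h (2*r-q) = h q" if "q \<le> 2*r" for q
    using that by (simp add: h_def)
  define m where "m = Max (h ` {..2*r})"
  have hm: "h q \<le> m" if "q \<le> 2*r" for q
    unfolding m_def using that by (intro Max_ge) auto
  \<comment> \<open>In \<open>amgm\<close> both indices are at most \<open>r\<close>. The pairs
    \<open>(0, q)\<close> and \<open>(r - q, r)\<close> satisfy this when \<open>q \<le> r\<close>;
    larger \<open>q\<close> are reached through the symmetry of \<open>h\<close>.\<close>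
  have half: "2 * h q \<le> h 0 + m" if "q \<le> r" for q
  proof -
    have eqs: "r - q + r = 2*r - q" "2*(r-q) = 2*r - 2*q"
      using that by auto
    have "2 * f q \<le> f 0 + f (2*q)"
      using amgm[of 0 q] that by simp
    moreover have "2 * f (2*r-q) \<le> f (2*r) + f (2*r-2*q)"
      using amgm[of "r-q" r] that unfolding eqs by simp
    ultimately have "2 * h q \<le> h 0 + h (2*q)"
      by (simp add: h_def)
    with hm[of "2*q"] that show ?thesis by linarith
  qed
  have all: "2 * h q \<le> h 0 + m" if "q \<le> 2*r" for q
    using half[of q] half[of "2*r-q"] h_sym[OF that] that by (cases "q \<le> r") auto
  have "m \<in> h ` {..2*r}"
    unfolding m_def by (intro Max_in) auto
  with all have "m \<le> h 0" by force
  have "2 * (\<Sum>q\<le>2*r. f q) = (\<Sum>q\<le>2*r. f q) + (\<Sum>q\<le>2*r. f (2*r-q))"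
    using sum.nat_diff_reindex[of f "Suc (2*r)"] by (simp add: lessThan_Suc_atMost)
  also have "\<dots> = (\<Sum>q\<le>2*r. h q)"
    by (simp add: h_def sum.distrib)
  also have "\<dots> \<le> (\<Sum>q\<le>2*r. h 0)"
    by (intro sum_mono) (use hm \<open>m \<le> h 0\<close> in force)
  also have "\<dots> = (2 * real r + 1) * (f (2*r) + f 0)"
    by (simp add: h_def algebra_simps)
  also have "f 0 = hs_norm2 (\<lambda>x. H ((Y ^^ r) x))"
    using fG[of 0 0] by (simp add: G_def hs_norm2_def dot_square_norm)
  also have "f (2*r) = hs_norm2 (\<lambda>x. H ((W ^^ r) x))"
  \<comment> \<open>\<open>fG\<close> with both indices \<open>r\<close> would give the norms of
    \<open>W^r H e\<close>; a cyclic exchange of the two halves puts \<open>H\<close> on the outside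
    instead.\<close>
  proof -
    have "f (2*r) = trace (\<lambda>x. (H ((W ^^ r) ((W ^^ r) (H x)))))"
      by (simp add: f_def mult_2 funpow_add)
    also have "\<dots> = trace (\<lambda>x. (W ^^ r) (H (H ((W ^^ r) x))))"
      by (rule trace_cyclic[of "\<lambda>x. H ((W ^^ r) x)" "\<lambda>x. (W ^^ r) (H x)"])
        (auto intro: lin_HWHY lin_HW lin_WH linp invp span_base)
    also have "\<dots> = hs_norm2 (\<lambda>x. H ((W ^^ r) x))"
      by (simp add: trace_def hs_norm2_def self_adjoint_funpow[OF sa(2)] sa(1) dot_square_norm[symmetric])
    finally show ?thesis .
  qed
  finally show ?thesis by (simp add: f_def)
qed

end

section \<open>Operators between zero and the identity, and a telescoping identity\<close>

lemma nonneg_op_Cauchy_Schwarz: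
  assumes "nonneg_op T"
  shows "(blinfun_apply T x \<bullet> y)\<^sup>2 \<le> (blinfun_apply T x \<bullet> x) * (blinfun_apply T y \<bullet> y)"
proof -
  define a b c where "a = blinfun_apply T x \<bullet> x" and "b = blinfun_apply T x \<bullet> y"
    and "c = blinfun_apply T y \<bullet> y"
  \<comment> \<open>The discriminant argument: this quadratic in \<open>t\<close> is the form
    evaluated at \<open>x + t y\<close>. For \<open>c > 0\<close> it is used at its minimizer
    \<open>- b / c\<close>.\<close>
  have quad: "0 \<le> a + 2 * t * b + t\<^sup>2 * c" for t
  proof -
    have yx: "blinfun_apply T y \<bullet> x = b"
      using assms by (simp add: b_def nonneg_op_def self_adjoint_def inner_commute)
    have "0 \<le> blinfun_apply T (x + t *\<^sub>R y) \<bullet> (x + t *\<^sub>R y)"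
      using assms by (simp add: nonneg_op_def)
    also have "\<dots> = a + 2 * t * b + t\<^sup>2 * c"
      by (simp add: blinfun.add_right blinfun.scaleR_right inner_add_left inner_add_right yx
          a_def[symmetric] b_def[symmetric] c_def[symmetric] algebra_simps power2_eq_square)
    finally show ?thesis .
  qed
  have "a \<ge> 0" "c \<ge> 0"
    using assms by (simp_all add: a_def c_def nonneg_op_def)
  show ?thesis
  proof (cases "c = 0")
    case True
    have "b = 0"
    proof (rule ccontr)
      assume "b \<noteq> 0"
      \<comment> \<open>With \<open>c = 0\<close> the polynomial is affine, and at this
        \<open>t\<close> it equals -1.\<close>
      with quad[of "- (a + 1) / (2 * b)"] True show False by (simp add: field_simps)
    qed
    with True show ?thesis by (simp add: b_def c_def)
  next
    case False
    with \<open>c \<ge> 0\<close> have "c > 0" by simp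
    have "0 \<le> c * (a + 2 * (- b / c) * b + (- b / c)\<^sup>2 * c)"
      using quad[of "- b / c"] \<open>c > 0\<close> by simp
    also have "\<dots> = a * c - b\<^sup>2"
      using \<open>c > 0\<close> by (simp add: field_simps power2_eq_square)
    finally show ?thesis by (simp add: a_def b_def c_def)
  qed
qed

text \<open>This is \<open>T^2 \<preceq> T\<close>, obtained without a square root of
  \<open>T\<close>: apply Cauchy-Schwarz for the form of \<open>T\<close> to \<open>x\<close> and
  \<open>T x\<close>, bound the second factor by \<open>T \<preceq> id_blinfun\<close>, and cancel
  the squared norm of \<open>T x\<close>.\<close>

lemma norm_square_le_inner:
  assumes "0 \<preceq> T" "T \<preceq> id_blinfun"
  shows "(norm (blinfun_apply T x))\<^sup>2 \<le> blinfun_apply T x \<bullet> x"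
proof (cases "blinfun_apply T x = 0")
  case False
  let ?y = "blinfun_apply T x"
  have T: "nonneg_op T" using assms(1) by (simp add: op_le_def)
  have "((norm ?y)\<^sup>2)\<^sup>2 = (?y \<bullet> ?y)\<^sup>2"
    by (simp add: dot_square_norm)
  also have "\<dots> \<le> (?y \<bullet> x) * (blinfun_apply T ?y \<bullet> ?y)"
    by (rule nonneg_op_Cauchy_Schwarz[OF T])
  also have "\<dots> \<le> (?y \<bullet> x) * (norm ?y)\<^sup>2"
  proof (rule mult_left_mono)
    have "0 \<le> blinfun_apply (id_blinfun - T) ?y \<bullet> ?y"
      using assms(2) by (simp add: op_le_def nonneg_op_def)
    then show "blinfun_apply T ?y \<bullet> ?y \<le> (norm ?y)\<^sup>2"
      by (simp add: blinfun.diff_left inner_diff_left dot_square_norm)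
    show "0 \<le> ?y \<bullet> x" using T by (simp add: nonneg_op_def)
  qed
  finally have "(norm ?y)\<^sup>2 * (norm ?y)\<^sup>2 \<le> (?y \<bullet> x) * (norm ?y)\<^sup>2"
    by (simp only: power2_eq_square[of "(norm ?y)\<^sup>2"])
  then show ?thesis by (rule mult_right_le_imp_le) (use False in simp)
qed simp

lemma norm_le_one_if_le_id:
  assumes "0 \<preceq> T" "T \<preceq> id_blinfun"
  shows "norm T \<le> 1"
proof (rule norm_blinfun_bound)
  fix x
  have "norm (blinfun_apply T x) * norm (blinfun_apply T x) \<le> norm (blinfun_apply T x) * norm x"
    using norm_square_le_inner[OF assms, of x] norm_cauchy_schwarz[of "blinfun_apply T x" x]
    by (simp add: power2_eq_square)
  then show "norm (blinfun_apply T x) \<le> 1 * norm x"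
    by (cases "norm (blinfun_apply T x) = 0") simp_all
qed simp

text \<open>The noncommutative factorization of a difference of powers. It will be used for two
  Rademacher sums that differ in one sign, where the inner difference is a multiple of a single
  \<open>A k\<close>.\<close>

lemma funpow_diff_telescope:
  fixes f g :: "'a::real_vector \<Rightarrow> 'a"
  assumes "linear f"
  shows "(f ^^ Suc n) x - (g ^^ Suc n) x
    = (\<Sum>q\<le>n. (f ^^ q) (f ((g ^^ (n-q)) x) - g ((g ^^ (n-q)) x)))"
proof (induction n)
  case (Suc n)
  have "(f ^^ Suc (Suc n)) x - (g ^^ Suc (Suc n)) x
      = (f ((g ^^ Suc n) x) - g ((g ^^ Suc n) x)) + f ((f ^^ Suc n) x - (g ^^ Suc n) x)"
    by (simp add: linear_diff[OF assms])
  also have "\<dots> = (f ((g ^^ Suc n) x) - g ((g ^^ Suc n) x))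
      + (\<Sum>q\<le>n. (f ^^ Suc q) (f ((g ^^ (n-q)) x) - g ((g ^^ (n-q)) x)))"
    unfolding Suc.IH linear_sum[OF assms] by simp
  also have "\<dots> = (\<Sum>q\<le>Suc n. (f ^^ q) (f ((g ^^ (Suc n-q)) x) - g ((g ^^ (Suc n-q)) x)))"
    by (simp add: sum.atMost_Suc_shift del: sum.atMost_Suc)
  finally show ?case .
qed simp

section \<open>Rademacher sums of operators\<close>

text \<open>Averages over independent Rademacher signs are sums over the sets \<open>J\<close> of indices
  which carry the sign \<open>+1\<close>.\<close>

definition rademacher :: "'i set \<Rightarrow> 'i \<Rightarrow> real" where
  "rademacher J k = (if k \<in> J then 1 else - 1)"

text \<open>Symmetric difference with \<open>{k}\<close>, which negates the \<open>k\<close>-th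
  sign. Pairing each \<open>J\<close> with \<open>flip k J\<close> takes the place of averaging over
  that sign with the others held fixed.\<close>

definition flip :: "'i \<Rightarrow> 'i set \<Rightarrow> 'i set" where
  "flip k J = (if k \<in> J then J - {k} else insert k J)"

lemma flip_flip [simp]: "flip k (flip k J) = J"
  by (simp add: flip_def insert_absorb)

lemma rademacher_flip:
  "rademacher (flip k J) i = (if i = k then - rademacher J i else rademacher J i)"
  by (cases "k \<in> J"; cases "i = k") (simp_all add: flip_def rademacher_def)

lemma rademacher_square [simp]: "rademacher J k * rademacher J k = 1"
  by (simp add: rademacher_def)

lemma sum_Pow_flip:
  assumes "k \<in> I"
  shows "(\<Sum>J\<in>Pow I. f (flip k J)) = (\<Sum>J\<in>Pow I. f J)"
  by (rule sum.reindex_bij_witness[of _ "flip k" "flip k"])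
    (use assms in \<open>auto simp: flip_def split: if_splits\<close>)

context orthonormal_system
begin

lemma trace_sum: "trace (\<lambda>x. \<Sum>i\<in>S. f i x) = (\<Sum>i\<in>S. trace (f i))"
  unfolding trace_def inner_sum_left by (rule sum.swap)

lemma trace_scaleR: "trace (\<lambda>x. c *\<^sub>R f x) = c * trace f"
  by (simp add: trace_def sum_distrib_left)

lemma trace_diff: "trace (\<lambda>x. f x - g x) = trace f - trace g"
  by (simp add: trace_def inner_diff_left sum_subtractf)

end

text \<open>One fixed realization of the random operators, with \<open>B\<close> an orthonormal
  system whose span contains all their ranges. Only the signs remain random.\<close>

locale bounded_operator_family = orthonormal_system B
  for B :: "'a::real_inner set" +
  fixes I :: "'i set" and A :: "'i \<Rightarrow> 'a \<Rightarrow>\<^sub>L 'a" and v :: real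
  assumes finite_index: "finite I"
    and nonneg: "\<And>k. k \<in> I \<Longrightarrow> 0 \<preceq> A k"
    and le_id: "\<And>k. k \<in> I \<Longrightarrow> A k \<preceq> id_blinfun"
    and range_subset: "\<And>k x. k \<in> I \<Longrightarrow> blinfun_apply (A k) x \<in> span B"
    and norm_sum_le: "norm (\<Sum>k\<in>I. A k) \<le> v"
begin

definition X :: "'i set \<Rightarrow> 'a \<Rightarrow>\<^sub>L 'a" where
  "X J = (\<Sum>k\<in>I. rademacher J k *\<^sub>R A k)"

lemma X_apply: "blinfun_apply (X J) x = (\<Sum>k\<in>I. rademacher J k *\<^sub>R blinfun_apply (A k) x)"
  by (simp add: X_def blinfun.sum_left blinfun.scaleR_left)

lemma linear_apply: "linear (blinfun_apply T)" for T :: "'a \<Rightarrow>\<^sub>L 'a"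
  by (simp add: blinfun.bounded_linear_right bounded_linear.linear)

lemma A_self_adjoint:
  "k \<in> I \<Longrightarrow> blinfun_apply (A k) x \<bullet> y = x \<bullet> blinfun_apply (A k) y"
  using nonneg by (simp add: op_le_def nonneg_op_def self_adjoint_def)

lemma X_self_adjoint: "blinfun_apply (X J) x \<bullet> y = x \<bullet> blinfun_apply (X J) y"
  by (simp add: X_apply inner_sum_left inner_sum_right A_self_adjoint)

lemma X_range: "blinfun_apply (X J) x \<in> span B"
  unfolding X_apply by (intro span_sum span_scale range_subset)

lemma X_flip_diff:
  assumes "k \<in> I"
  shows "blinfun_apply (X J) x - blinfun_apply (X (flip k J)) x
    = (2 * rademacher J k) *\<^sub>R blinfun_apply (A k) x"
proof -
  have "blinfun_apply (X J) x - blinfun_apply (X (flip k J)) x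
    = (\<Sum>i\<in>I. if i = k then (2 * rademacher J k) *\<^sub>R blinfun_apply (A k) x else 0)"
    unfolding X_apply sum_subtractf[symmetric]
  proof (intro sum.cong refl)
    fix i assume "i \<in> I"
    show "rademacher J i *\<^sub>R blinfun_apply (A i) x - rademacher (flip k J) i *\<^sub>R blinfun_apply (A i) x
      = (if i = k then (2 * rademacher J k) *\<^sub>R blinfun_apply (A k) x else 0)"
      by (cases "i = k") (simp_all add: rademacher_flip flip: scaleR_left.diff scaleR_left.add scaleR_left_distrib)
  qed
  then show ?thesis using assms finite_index by simp
qed

text \<open>The variance bound: the sum of the \<open>A_k^2\<close> is at most the sum of the
  \<open>A_k\<close>, whose norm is at most \<open>v\<close>.\<close>

lemma sum_norm_square_le: "(\<Sum>k\<in>I. (norm (blinfun_apply (A k) y))\<^sup>2) \<le> v * (norm y)\<^sup>2"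
proof -
  have "(\<Sum>k\<in>I. (norm (blinfun_apply (A k) y))\<^sup>2) \<le> (\<Sum>k\<in>I. blinfun_apply (A k) y \<bullet> y)"
    by (intro sum_mono norm_square_le_inner nonneg le_id)
  also have "\<dots> = blinfun_apply (\<Sum>k\<in>I. A k) y \<bullet> y"
    by (simp add: blinfun.sum_left inner_sum_left)
  also have "\<dots> \<le> norm (blinfun_apply (\<Sum>k\<in>I. A k) y) * norm y"
    by (rule norm_cauchy_schwarz)
  also have "\<dots> \<le> v * norm y * norm y"
    by (intro mult_right_mono order_trans[OF norm_blinfun] norm_sum_le) auto
  finally show ?thesis by (simp add: power2_eq_square mult_ac)
qed

text \<open>Both sides are the trace of \<open>X^(2r+2)\<close>. Expanding only the outermost factor
  exposes one explicit sign per term, ready for exchanging that sign.\<close>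

lemma hs_norm2_funpow_Suc:
  "hs_norm2 (blinfun_apply (X J) ^^ Suc r)
    = (\<Sum>k\<in>I. rademacher J k *
        trace (\<lambda>x. blinfun_apply (A k) ((blinfun_apply (X J) ^^ Suc (2*r)) x)))"
proof -
  let ?f = "blinfun_apply (X J)"
  have "(norm ((?f ^^ Suc r) e))\<^sup>2 = ?f ((?f ^^ Suc (2*r)) e) \<bullet> e" for e
  proof -
    have "(norm ((?f ^^ Suc r) e))\<^sup>2 = (?f ^^ Suc r) ((?f ^^ Suc r) e) \<bullet> e"
      using self_adjoint_funpow[of ?f "Suc r" "(?f ^^ Suc r) e" e, OF X_self_adjoint]
      by (simp only: power2_norm_eq_inner)
    also have "(?f ^^ Suc r) ((?f ^^ Suc r) e) = (?f ^^ (Suc r + Suc r)) e"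
      by (simp only: funpow_add o_apply)
    finally show ?thesis by (simp add: mult_2)
  qed
  then have "hs_norm2 (?f ^^ Suc r) = trace (\<lambda>x. ?f ((?f ^^ Suc (2*r)) x))"
    by (simp only: hs_norm2_def trace_def)
  also have "\<dots> = (\<Sum>k\<in>I. rademacher J k * trace (\<lambda>x. blinfun_apply (A k) ((?f ^^ Suc (2*r)) x)))"
    unfolding X_apply[of J "(_ ^^ _) _"] trace_sum trace_scaleR ..
  finally show ?thesis .
qed

text \<open>A discrete integration by parts in the \<open>k\<close>-th sign. The explicit sign turns
  the pair into a difference of powers; telescoping produces a second \<open>A k\<close> and a
  second sign, and the two signs square to one. The \<open>2r + 1\<close> mixed words are then
  controlled by \<open>trace_mixed_power_sum_le\<close>.\<close>

lemma trace_flip_le: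
  fixes r :: nat
  assumes k: "k \<in> I"
  defines "t \<equiv> \<lambda>J. rademacher J k *
        trace (\<lambda>x. blinfun_apply (A k) ((blinfun_apply (X J) ^^ Suc (2*r)) x))"
    and "w \<equiv> \<lambda>J. hs_norm2 (\<lambda>x. blinfun_apply (A k) ((blinfun_apply (X J) ^^ r) x))"
  shows "t J + t (flip k J) \<le> (2 * real r + 1) * (w J + w (flip k J))"
proof -
  let ?s = "rademacher J k"
  let ?H = "blinfun_apply (A k)"
  let ?W = "blinfun_apply (X J)"
  let ?Y = "blinfun_apply (X (flip k J))"
  have "t J + t (flip k J)
      = ?s * trace (\<lambda>x. ?H ((?W ^^ Suc (2*r)) x - (?Y ^^ Suc (2*r)) x))"
    by (simp add: t_def rademacher_flip trace_diff blinfun.diff_right algebra_simps)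
  also have "\<dots> = ?s * trace (\<lambda>x. \<Sum>q\<le>2*r. (2 * ?s) *\<^sub>R ?H ((?W ^^ q) (?H ((?Y ^^ (2*r-q)) x))))"
    unfolding funpow_diff_telescope[OF linear_apply] X_flip_diff[OF k]
    by (simp only: blinfun.sum_right blinfun.scaleR_right linear_scale[OF linear_funpow[OF linear_apply]])
  also have "\<dots> = 2 * (\<Sum>q\<le>2*r. trace (\<lambda>x. ?H ((?W ^^ q) (?H ((?Y ^^ (2*r-q)) x)))))"
    unfolding trace_sum trace_scaleR
    by (simp only: sum_distrib_left mult.assoc[symmetric] mult.commute[of ?s 2] rademacher_square)
      (simp add: mult.assoc sum_distrib_left)
  also have "\<dots> \<le> (2 * real r + 1) * (w J + w (flip k J))"
    unfolding w_def
    by (rule trace_mixed_power_sum_le)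
      (use k in \<open>auto intro: linear_apply A_self_adjoint X_self_adjoint X_range range_subset\<close>)
  finally show ?thesis .
qed

text \<open>Summing \<open>trace_flip_le\<close> over \<open>J\<close> counts every set twice on
  both sides, as \<open>flip k\<close> permutes \<open>Pow I\<close>. The sum over \<open>k\<close>
  collapses by the variance bound at the vectors \<open>X^r e\<close>.\<close>

lemma sum_hs_norm2_funpow_Suc_le:
  "(\<Sum>J\<in>Pow I. hs_norm2 (blinfun_apply (X J) ^^ Suc r))
    \<le> (2 * real r + 1) * v * (\<Sum>J\<in>Pow I. hs_norm2 (blinfun_apply (X J) ^^ r))"
proof -
  define t where "t k J = rademacher J k *
        trace (\<lambda>x. blinfun_apply (A k) ((blinfun_apply (X J) ^^ Suc (2*r)) x))" for k J
  define w where "w k J = hs_norm2 (\<lambda>x. blinfun_apply (A k) ((blinfun_apply (X J) ^^ r) x))" for k J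
  have "2 * (\<Sum>J\<in>Pow I. t k J) \<le> 2 * ((2 * real r + 1) * (\<Sum>J\<in>Pow I. w k J))" if k: "k \<in> I" for k
  proof -
    have "2 * (\<Sum>J\<in>Pow I. t k J) = (\<Sum>J\<in>Pow I. t k J + t k (flip k J))"
      by (simp add: sum.distrib sum_Pow_flip[OF k])
    also have "\<dots> \<le> (\<Sum>J\<in>Pow I. (2 * real r + 1) * (w k J + w k (flip k J)))"
      unfolding t_def w_def by (intro sum_mono trace_flip_le k)
    also have "\<dots> = (2 * real r + 1) * ((\<Sum>J\<in>Pow I. w k J) + (\<Sum>J\<in>Pow I. w k (flip k J)))"
      by (simp only: sum_distrib_left[symmetric] sum.distrib)
    also have "\<dots> = 2 * ((2 * real r + 1) * (\<Sum>J\<in>Pow I. w k J))"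
      by (simp only: sum_Pow_flip[OF k]) simp
    finally show ?thesis .
  qed
  then have tw: "(\<Sum>J\<in>Pow I. t k J) \<le> (2 * real r + 1) * (\<Sum>J\<in>Pow I. w k J)" if "k \<in> I" for k
    using that by fastforce
  have wv: "(\<Sum>k\<in>I. w k J) \<le> v * hs_norm2 (blinfun_apply (X J) ^^ r)" for J
    unfolding w_def hs_norm2_def sum_distrib_left
    by (subst sum.swap) (intro sum_mono sum_norm_square_le)
  have "(\<Sum>J\<in>Pow I. hs_norm2 (blinfun_apply (X J) ^^ Suc r)) = (\<Sum>k\<in>I. \<Sum>J\<in>Pow I. t k J)"
    unfolding hs_norm2_funpow_Suc t_def by (rule sum.swap)
  also have "\<dots> \<le> (\<Sum>k\<in>I. (2 * real r + 1) * (\<Sum>J\<in>Pow I. w k J))"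
    by (intro sum_mono tw)
  also have "\<dots> = (2 * real r + 1) * (\<Sum>J\<in>Pow I. \<Sum>k\<in>I. w k J)"
    by (subst sum.swap) (simp add: sum_distrib_left)
  also have "\<dots> \<le> (2 * real r + 1) * (\<Sum>J\<in>Pow I. v * hs_norm2 (blinfun_apply (X J) ^^ r))"
    by (intro mult_left_mono sum_mono wv) auto
  finally show ?thesis by (simp add: sum_distrib_left mult.assoc)
qed

lemma v_nonneg: "v \<ge> 0"
  using norm_sum_le norm_ge_zero by (rule order_trans[rotated])

text \<open>Iterating the recursion from \<open>hs_norm2\<close> of the identity, which is
  \<open>card B\<close>. The quotient of factorials is \<open>(2r - 1)!!\<close>, the
  \<open>2r\<close>-th moment of a standard Gaussian.\<close>

lemma sum_hs_norm2_funpow_le: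
  "(\<Sum>J\<in>Pow I. hs_norm2 (blinfun_apply (X J) ^^ r))
    \<le> 2 ^ card I * real (card B) * (fact (2 * r) / (2 ^ r * fact r) * v ^ r)"
proof (induction r)
  case 0
  then show ?case
    using finite_index by (simp add: hs_norm2_def norm_basis card_Pow)
next
  case (Suc r)
  have "(\<Sum>J\<in>Pow I. hs_norm2 (blinfun_apply (X J) ^^ Suc r))
      \<le> (2 * real r + 1) * v * (\<Sum>J\<in>Pow I. hs_norm2 (blinfun_apply (X J) ^^ r))"
    by (rule sum_hs_norm2_funpow_Suc_le)
  also have "\<dots> \<le> (2 * real r + 1) * v *
      (2 ^ card I * real (card B) * (fact (2 * r) / (2 ^ r * fact r) * v ^ r))"
    by (intro mult_left_mono Suc) (simp add: v_nonneg)
  also have "\<dots> = 2 ^ card I * real (card B) * ((2 * real r + 1) * (fact (2 * r) / (2 ^ r * fact r)) * v ^ Suc r)"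
    by simp
  also have "(2 * real r + 1) * (fact (2 * r) / (2 ^ r * fact r))
      = fact (2 * Suc r) / (2 ^ Suc r * fact (Suc r))"
  proof -
    have "(fact (2 * Suc r) :: real) = (2 * real (Suc r)) * (2 * real r + 1) * fact (2 * r)"
      by (simp add: algebra_simps)
    moreover have "(2::real) ^ Suc r * fact (Suc r) = (2 * real (Suc r)) * (2 ^ r * fact r)"
      by simp
    ultimately show ?thesis
      by (simp only: mult.assoc) simp
  qed
  finally show ?case .
qed

lemma sum_norm_power_le:
  assumes "card B \<le> d" "d \<ge> 1"
  shows "(\<Sum>J\<in>Pow I. norm (X J) ^ (2 * r))
    \<le> 2 ^ card I * real d * (fact (2 * r) / (2 ^ r * fact r) * v ^ r)"
proof (cases "r = 0")
  \<comment> \<open>A zeroth power is 1 even if \<open>B\<close> is empty, where the trace bound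
    would give 0; here \<open>d \<ge> 1\<close> is what helps.\<close>
  case True
  then show ?thesis using assms finite_index by (simp add: card_Pow)
next
  case False
  have "(\<Sum>J\<in>Pow I. norm (X J) ^ (2 * r)) \<le> (\<Sum>J\<in>Pow I. hs_norm2 (blinfun_apply (X J) ^^ r))"
    using False
    by (intro sum_mono norm_blinfun_power_le_hs_norm2 X_range)
      (auto simp: self_adjoint_def X_self_adjoint)
  also have "\<dots> \<le> 2 ^ card I * real (card B) * (fact (2 * r) / (2 ^ r * fact r) * v ^ r)"
    by (rule sum_hs_norm2_funpow_le)
  also have "\<dots> \<le> 2 ^ card I * real d * (fact (2 * r) / (2 ^ r * fact r) * v ^ r)"
    using assms v_nonneg by (intro mult_right_mono) auto
  finally show ?thesis .
qed

text \<open>Bounding \<open>exp\<close> by \<open>2 cosh\<close> leaves only even moments. Dividing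
  \<open>(2r - 1)!!\<close> by \<open>(2r)!\<close> gives \<open>1 / (2^r r!)\<close>, so the
  termwise bounds add up to the exponential series.\<close>

lemma rademacher_sum_exp_norm_le:
  assumes "card B \<le> d" "d \<ge> 1"
  shows "(\<Sum>J\<in>Pow I. exp (t * norm (X J))) \<le> 2 ^ card I * (2 * real d * exp (t\<^sup>2 * v / 2))"
proof -
  have even_series: "(\<lambda>r. 2 * (t * x) ^ (2 * r) / fact (2 * r)) sums (2 * cosh (t * x))" for x
  proof -
    have "strict_mono (\<lambda>r::nat. 2 * r)"
      by (simp add: strict_mono_def)
    then have "(\<lambda>r. if even (2 * r) then (t * x) ^ (2 * r) /\<^sub>R fact (2 * r) else 0) sums cosh (t * x)"
      using cosh_converges[of "t * x"]
      by (subst sums_mono_reindex) (auto elim!: evenE simp: image_iff)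
    from sums_mult[OF this, of 2] show ?thesis
      by (simp add: divide_inverse mult_ac)
  qed
  have lhs: "(\<lambda>r. \<Sum>J\<in>Pow I. 2 * (t * norm (X J)) ^ (2 * r) / fact (2 * r))
      sums (\<Sum>J\<in>Pow I. 2 * cosh (t * norm (X J)))"
    by (intro sums_sum even_series)
  have rhs: "(\<lambda>r. 2 ^ card I * (2 * real d) * ((t\<^sup>2 * v / 2) ^ r /\<^sub>R fact r))
      sums (2 ^ card I * (2 * real d) * exp (t\<^sup>2 * v / 2))"
    by (intro sums_mult exp_converges)
  have le: "(\<Sum>J\<in>Pow I. 2 * (t * norm (X J)) ^ (2 * r) / fact (2 * r))
      \<le> 2 ^ card I * (2 * real d) * ((t\<^sup>2 * v / 2) ^ r /\<^sub>R fact r)" for r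
  proof -
    have "(\<Sum>J\<in>Pow I. 2 * (t * norm (X J)) ^ (2 * r) / fact (2 * r))
        = 2 * t ^ (2 * r) / fact (2 * r) * (\<Sum>J\<in>Pow I. norm (X J) ^ (2 * r))"
      by (simp add: sum_distrib_left power_mult_distrib mult.assoc)
    also have "\<dots> \<le> 2 * t ^ (2 * r) / fact (2 * r) *
        (2 ^ card I * real d * (fact (2 * r) / (2 ^ r * fact r) * v ^ r))"
      by (intro mult_left_mono sum_norm_power_le assms) (simp add: power_mult)
    also have "\<dots> = 2 ^ card I * (2 * real d) * ((t\<^sup>2 * v / 2) ^ r /\<^sub>R fact r)"
    proof -
      have "(t\<^sup>2 * v / 2) ^ r = t ^ (2 * r) * v ^ r / 2 ^ r"
        by (simp add: power_mult power_mult_distrib power_divide)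
      moreover have "2 * T / F * (P * D * (F / (p * q) * V)) = P * (2 * D) * (T * V / p /\<^sub>R q)"
        if "F \<noteq> 0" for T F P D p q V :: real
        using that by (simp add: divide_inverse)
      from this[OF fact_nonzero]
      have "2 * t ^ (2 * r) / fact (2 * r) * (2 ^ card I * real d * (fact (2 * r) / (2 ^ r * fact r) * v ^ r))
        = 2 ^ card I * (2 * real d) * (t ^ (2 * r) * v ^ r / 2 ^ r /\<^sub>R fact r)" .
      ultimately show ?thesis
        by (simp only:)
    qed
    finally show ?thesis .
  qed
  have "(\<Sum>J\<in>Pow I. exp (t * norm (X J))) \<le> (\<Sum>J\<in>Pow I. 2 * cosh (t * norm (X J)))"
    by (intro sum_mono) (simp add: cosh_def)
  also have "\<dots> \<le> 2 ^ card I * (2 * real d) * exp (t\<^sup>2 * v / 2)"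
    by (rule sums_le[OF le lhs rhs])
  finally show ?thesis by (simp only: mult.assoc)
qed

end

lemma rademacher_exp_norm_le:
  fixes A :: "'i \<Rightarrow> 'a::real_inner \<Rightarrow>\<^sub>L 'a"
  assumes "finite I" "\<And>k. k \<in> I \<Longrightarrow> 0 \<preceq> A k" "\<And>k. k \<in> I \<Longrightarrow> A k \<preceq> id_blinfun"
    and dim: "finite_dim_le (span (\<Union>k\<in>I. range (blinfun_apply (A k)))) d" and "d \<ge> 1"
  shows "(\<Sum>J\<in>Pow I. exp (t * norm (\<Sum>k\<in>I. rademacher J k *\<^sub>R A k)))
    \<le> 2 ^ card I * (2 * real d * exp (t\<^sup>2 * norm (\<Sum>k\<in>I. A k) / 2))"
proof -
  let ?V = "span (\<Union>k\<in>I. range (blinfun_apply (A k)))"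
  obtain C where C: "C \<subseteq> ?V" "independent C" "?V \<subseteq> span C" "card C = dim ?V"
    using basis_exists[of ?V] by blast
  \<comment> \<open>An infinite \<open>C\<close> would have cardinality 0, making the bound on
    \<open>dim\<close> empty; the finite spanning set in \<open>finite_dim_le\<close> excludes
    this.\<close>
  have "finite C"
    using dim C(1,2) independent_span_bound[of _ C] unfolding finite_dim_le_def by blast
  then obtain B where B: "finite B" "pairwise orthogonal B" "\<And>e. e \<in> B \<Longrightarrow> norm e = 1"
    "card B \<le> card C" "C \<subseteq> span B"
    using orthonormal_spanning_set_exists by blast
  have "?V \<subseteq> span B"
    using C(3) B(5) span_minimal[OF _ subspace_span] by blast
  then have range: "blinfun_apply (A k) x \<in> span B" if "k \<in> I" for k x
    using that by (meson UN_I rangeI span_base subsetD)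
  interpret bounded_operator_family B I A "norm (\<Sum>k\<in>I. A k)"
    using B assms(1-3) range by unfold_locales auto
  have "card B \<le> d"
    using B(4) C(4) dim by (simp add: finite_dim_le_def)
  from rademacher_sum_exp_norm_le[OF this \<open>d \<ge> 1\<close>] show ?thesis
    by (simp add: X_def)
qed

section \<open>Symmetrization\<close>

text \<open>The coefficients and the shift cover signed sums and centred sums at once.\<close>

lemma operator_sum_measurable:
  fixes F :: "'i \<Rightarrow> 'w \<Rightarrow> ('a::real_normed_vector \<Rightarrow>\<^sub>L 'b::{real_normed_vector, second_countable_topology})"
  assumes "\<And>k. k \<in> I \<Longrightarrow> F k \<in> M \<rightarrow>\<^sub>M operator_algebra"
  shows "(\<lambda>\<omega>. (\<Sum>k\<in>I. a k *\<^sub>R F k \<omega>) - T) \<in> M \<rightarrow>\<^sub>M operator_algebra"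
proof (rule measurable_operator_algebraI)
  fix x
  have "(\<lambda>\<omega>. blinfun_apply (F k \<omega>) x) \<in> borel_measurable M" if "k \<in> I" for k
    using measurable_compose[OF assms[OF that] measurable_operator_eval] .
  then show "(\<lambda>\<omega>. blinfun_apply ((\<Sum>k\<in>I. a k *\<^sub>R F k \<omega>) - T) x) \<in> borel_measurable M"
    by (simp add: blinfun.diff_left blinfun.sum_left blinfun.scaleR_left)
qed

text \<open>By independence the joint law of the \<open>X k\<close> is the product of their laws,
  and the coordinates selected by an injective \<open>f\<close> from a larger product have that same
  law. It allows either copy to be read off the doubled product space.\<close>

lemma nn_integral_PiM_distr_reindex:
  fixes X :: "'i \<Rightarrow> 'w \<Rightarrow> 'b" and f :: "'i \<Rightarrow> 'j"
  assumes M: "prob_space M" and indep: "prob_space.indep_vars M (\<lambda>_. E) X I" and "I \<noteq> {}"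
    and prob: "\<And>j. j \<in> K \<Longrightarrow> prob_space (D j)"
    and D: "\<And>k. k \<in> I \<Longrightarrow> D (f k) = distr M E (X k)"
    and f: "inj_on f I" "f \<in> I \<rightarrow> K"
    and F: "F \<in> borel_measurable (Pi\<^sub>M I (\<lambda>_. E))"
  shows "(\<integral>\<^sup>+z. F (\<lambda>k\<in>I. z (f k)) \<partial>Pi\<^sub>M K D) = (\<integral>\<^sup>+\<omega>. F (\<lambda>k\<in>I. X k \<omega>) \<partial>M)"
proof -
  interpret prob_space M by fact
  have X: "X k \<in> M \<rightarrow>\<^sub>M E" if "k \<in> I" for k
    using indep that by (auto simp: indep_vars_def)
  have sets: "sets (Pi\<^sub>M I (\<lambda>k. D (f k))) = sets (Pi\<^sub>M I (\<lambda>_. E))"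
    by (rule sets_PiM_cong) (simp_all add: D)
  have "(\<lambda>z. z (f k)) \<in> Pi\<^sub>M K D \<rightarrow>\<^sub>M D (f k)" if "k \<in> I" for k
    using f that by (intro measurable_component_singleton) auto
  then have meas: "(\<lambda>z. \<lambda>k\<in>I. z (f k)) \<in> Pi\<^sub>M K D \<rightarrow>\<^sub>M Pi\<^sub>M I (\<lambda>k. D (f k))"
    by (intro measurable_restrict)
  have "(\<integral>\<^sup>+z. F (\<lambda>k\<in>I. z (f k)) \<partial>Pi\<^sub>M K D)
      = integral\<^sup>N (distr (Pi\<^sub>M K D) (Pi\<^sub>M I (\<lambda>k. D (f k))) (\<lambda>z. \<lambda>k\<in>I. z (f k))) F"
    using F by (intro nn_integral_distr[symmetric] meas) (simp add: measurable_cong_sets[OF sets])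
  also have "distr (Pi\<^sub>M K D) (Pi\<^sub>M I (\<lambda>k. D (f k))) (\<lambda>z. \<lambda>k\<in>I. z (f k)) = Pi\<^sub>M I (\<lambda>k. D (f k))"
    by (rule distr_PiM_reindex) (use prob f in auto)
  also have "\<dots> = Pi\<^sub>M I (\<lambda>k. distr M E (X k))"
    by (rule PiM_cong) (simp_all add: D)
  also have "\<dots> = distr M (Pi\<^sub>M I (\<lambda>_. E)) (\<lambda>\<omega>. \<lambda>k\<in>I. X k \<omega>)"
    using indep_vars_iff_distr_eq_PiM'[where I = I and M' = "\<lambda>_. E" and X = X] indep \<open>I \<noteq> {}\<close> X by simp
  also have "integral\<^sup>N \<dots> F = (\<integral>\<^sup>+\<omega>. F (\<lambda>k\<in>I. X k \<omega>) \<partial>M)"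
    by (rule nn_integral_distr) (auto simp: F intro!: measurable_restrict X)
  finally show ?thesis .
qed

text \<open>Triangle inequality, then the arithmetic-geometric mean inequality. Doubling the
  exponent is the price for separating the two copies.\<close>

lemma exp_norm_sum_le:
  fixes x y :: "'a::real_normed_vector"
  assumes "t \<ge> 0"
  shows "exp (t * norm (x - y)) \<le> exp (2 * t * norm x) / 2 + exp (2 * t * norm y) / 2"
proof -
  have "exp (t * norm (x - y)) \<le> exp (t * norm x + t * norm y)"
    using mult_left_mono[OF norm_triangle_ineq4[of x y] assms] by (simp add: distrib_left)
  also have "\<dots> = exp (t * norm x) * exp (t * norm y)"
    by (rule exp_add)
  also have "\<dots> \<le> ((exp (t * norm x))\<^sup>2 + (exp (t * norm y))\<^sup>2) / 2"
    using sum_squares_bound[of "exp (t * norm x)" "exp (t * norm y)"] by simp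
  also have "\<dots> = exp (2 * t * norm x) / 2 + exp (2 * t * norm y) / 2"
    by (simp add: exp_double[symmetric] mult.assoc add_divide_distrib)
  finally show ?thesis .
qed

text \<open>Jensen's inequality in two stages: the norm of the mean is at most the mean norm,
  checked vector by vector, and then convexity of \<open>exp\<close>. The almost sure bound supplies
  integrability.\<close>

lemma exp_norm_diff_expectation_le:
  fixes Y :: "'i \<Rightarrow> 'w \<Rightarrow> ('a::{real_normed_vector, second_countable_topology} \<Rightarrow>\<^sub>L 'b::{banach, second_countable_topology})"
  assumes M: "prob_space M" and Y: "\<And>k. k \<in> I \<Longrightarrow> Y k \<in> M \<rightarrow>\<^sub>M operator_algebra"
    and bounded: "\<And>k. k \<in> I \<Longrightarrow> AE \<omega> in M. norm (Y k \<omega>) \<le> C" and "finite I" and t: "t \<ge> 0"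
  shows "ennreal (exp (t * norm (S - (\<Sum>k\<in>I. op_expectation M (Y k)))))
    \<le> (\<integral>\<^sup>+\<omega>. ennreal (exp (t * norm (S - (\<Sum>k\<in>I. Y k \<omega>)))) \<partial>M)"
proof -
  interpret prob_space M by fact
  define g where "g \<omega> = norm (S - (\<Sum>k\<in>I. Y k \<omega>))" for \<omega>
  define R where "R = norm S + (\<Sum>k\<in>I. C)"
  have AE_all: "AE \<omega> in M. \<forall>k\<in>I. norm (Y k \<omega>) \<le> C"
    using bounded \<open>finite I\<close> by (simp add: AE_finite_all)
  have "(\<lambda>\<omega>. (\<Sum>k\<in>I. 1 *\<^sub>R Y k \<omega>) - S) \<in> M \<rightarrow>\<^sub>M operator_algebra"
    by (rule operator_sum_measurable) (rule Y)
  from measurable_compose[OF this measurable_operator_norm]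
  have g_meas [measurable]: "g \<in> borel_measurable M"
    by (simp add: g_def[abs_def] norm_minus_commute)
  have g_bound: "AE \<omega> in M. g \<omega> \<le> R"
    using AE_all
  proof eventually_elim
    fix \<omega> assume *: "\<forall>k\<in>I. norm (Y k \<omega>) \<le> C"
    have "g \<omega> \<le> norm S + norm (\<Sum>k\<in>I. Y k \<omega>)"
      unfolding g_def by (rule norm_triangle_ineq4)
    also have "norm (\<Sum>k\<in>I. Y k \<omega>) \<le> (\<Sum>k\<in>I. C)"
      using * by (intro sum_norm_le) auto
    finally show "g \<omega> \<le> R" by (simp add: R_def)
  qed
  have g_nonneg: "g \<omega> \<ge> 0" for \<omega> by (simp add: g_def)
  have int_g: "integrable M g"
    using g_bound by (intro integrable_const_bound[of g R]) (auto simp: g_nonneg)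
  have int_exp: "integrable M (\<lambda>\<omega>. exp (t * g \<omega>))"
    using g_bound
    by (intro integrable_const_bound[of _ "exp (t * R)"]) (auto simp: t mult_left_mono elim!: eventually_mono)
  have int_Y: "integrable M (\<lambda>\<omega>. blinfun_apply (Y k \<omega>) x)" if "k \<in> I" for k x
  proof (rule integrable_const_bound[of _ "C * norm x"])
    show "AE \<omega> in M. norm (blinfun_apply (Y k \<omega>) x) \<le> C * norm x"
      using bounded[OF that]
      by eventually_elim (meson mult_right_mono norm_blinfun norm_ge_zero order_trans)
    show "(\<lambda>\<omega>. blinfun_apply (Y k \<omega>) x) \<in> borel_measurable M"
      by (rule measurable_compose[OF Y[OF that] measurable_operator_eval])
  qed
  have "norm (S - (\<Sum>k\<in>I. op_expectation M (Y k))) \<le> expectation g"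
  proof (rule norm_blinfun_bound)
    show "0 \<le> expectation g"
      by (intro Bochner_Integration.integral_nonneg g_nonneg)
    fix x
    have int: "integrable M (\<lambda>\<omega>. blinfun_apply (S - (\<Sum>k\<in>I. Y k \<omega>)) x)"
      by (simp add: blinfun.diff_left blinfun.sum_left int_Y)
    have "blinfun_apply (S - (\<Sum>k\<in>I. op_expectation M (Y k))) x
        = expectation (\<lambda>\<omega>. blinfun_apply (S - (\<Sum>k\<in>I. Y k \<omega>)) x)"
      using int_Y
      by (simp add: blinfun.diff_left blinfun.sum_left prob_space
          op_expectation_apply[OF finite_measure_axioms Y bounded])
    also have "norm \<dots> \<le> expectation (\<lambda>\<omega>. norm (blinfun_apply (S - (\<Sum>k\<in>I. Y k \<omega>)) x))"
      by (rule integral_norm_bound)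
    also have "\<dots> \<le> expectation (\<lambda>\<omega>. g \<omega> * norm x)"
    proof (rule integral_mono)
      show "norm (blinfun_apply (S - (\<Sum>k\<in>I. Y k \<omega>)) x) \<le> g \<omega> * norm x" for \<omega>
        unfolding g_def by (rule norm_blinfun)
    qed (use int int_g in auto)
    also have "\<dots> = expectation g * norm x"
      by simp
    finally show "norm (blinfun_apply (S - (\<Sum>k\<in>I. op_expectation M (Y k))) x) \<le> expectation g * norm x" .
  qed
  then have "exp (t * norm (S - (\<Sum>k\<in>I. op_expectation M (Y k)))) \<le> exp (expectation (\<lambda>\<omega>. t * g \<omega>))"
    using t by (simp add: mult_left_mono)
  also have "\<dots> \<le> expectation (\<lambda>\<omega>. exp (t * g \<omega>))"
    using int_g int_exp
    by (intro jensens_inequality[where I = UNIV]) (auto simp: exp_convex)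
  finally have "ennreal (exp (t * norm (S - (\<Sum>k\<in>I. op_expectation M (Y k)))))
      \<le> ennreal (expectation (\<lambda>\<omega>. exp (t * g \<omega>)))"
    by (rule ennreal_leI)
  also have "\<dots> = (\<integral>\<^sup>+\<omega>. ennreal (exp (t * g \<omega>)) \<partial>M)"
    by (rule nn_integral_eq_integral[symmetric]) (simp_all add: int_exp)
  finally show ?thesis by (simp add: g_def)
qed

text \<open>The coordinates of \<open>\<Pi> (b, k). A\<^sub>k\<close> with \<open>b = True\<close> play the role of the original operators,
  those with \<open>b = False\<close> are the independent copy, and the signs are introduced by exchanging
  \<open>(True, k)\<close> and \<open>(False, k)\<close> for the indices \<open>k\<close> with a negative sign.\<close>

lemma symmetrization:
  fixes A :: "'i \<Rightarrow> 'w \<Rightarrow> ('a::{real_normed_vector, second_countable_topology} \<Rightarrow>\<^sub>L 'b::{banach, second_countable_topology})"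
  assumes M: "prob_space M" and indep: "prob_space.indep_vars M (\<lambda>_. operator_algebra) A I"
    and bounded: "\<And>k. k \<in> I \<Longrightarrow> AE \<omega> in M. norm (A k \<omega>) \<le> C" and I: "finite I"
    and t: "t \<ge> 0" and s: "\<And>k. k \<in> I \<Longrightarrow> s k = 1 \<or> s k = - 1"
  shows "(\<integral>\<^sup>+\<omega>. ennreal (exp (t * norm (\<Sum>k\<in>I. A k \<omega> - op_expectation M (A k)))) \<partial>M)
    \<le> (\<integral>\<^sup>+\<omega>. ennreal (exp (2 * t * norm (\<Sum>k\<in>I. s k *\<^sub>R A k \<omega>))) \<partial>M)"
proof (cases "I = {}")
  case False
  interpret prob_space M by fact
  let ?E = "operator_algebra :: ('a \<Rightarrow>\<^sub>L 'b) measure"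
  have A: "A k \<in> M \<rightarrow>\<^sub>M ?E" if "k \<in> I" for k
    using indep that by (auto simp: indep_vars_def)
  obtain k0 where "k0 \<in> I" using False by blast
  \<comment> \<open>Outside \<open>I\<close> the law of \<open>A k0\<close> serves as a default, so
    that every factor of the product is a probability measure.\<close>
  define D where "D j = distr M ?E (A (if snd j \<in> I then snd j else k0))" for j :: "bool \<times> 'i"
  have prob_D: "prob_space (D j)" for j
    unfolding D_def using A \<open>k0 \<in> I\<close> by (intro prob_space_distr) auto
  interpret D: product_sigma_finite D
    by (rule product_sigma_finite.intro) (rule prob_space_imp_sigma_finite[OF prob_D])
  have sets_D [measurable_cong]: "sets (D j) = sets ?E" for j
    by (simp add: D_def)
  have D_eq: "D (b, k) = distr M ?E (A k)" if "k \<in> I" for b k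
    using that by (simp add: D_def)
  define K where "K b = {b} \<times> I" for b :: bool
  have K: "K True \<inter> K False = {}" "finite (K b)" for b
    using I by (auto simp: K_def)
  define Q where "Q = Pi\<^sub>M (K True \<union> K False) D"
  define c where "c = (\<Sum>k\<in>I. op_expectation M (A k))"
  have comp: "(\<lambda>z. z j) \<in> Pi\<^sub>M L D \<rightarrow>\<^sub>M ?E" if "j \<in> L" for j L
    using measurable_component_singleton[OF that, of D] by (simp add: measurable_cong_sets[OF refl sets_D])
  have reindex: "(\<integral>\<^sup>+z. F (\<lambda>k\<in>I. z (f k)) \<partial>Pi\<^sub>M L D) = (\<integral>\<^sup>+\<omega>. F (\<lambda>k\<in>I. A k \<omega>) \<partial>M)"
    if "F \<in> borel_measurable (Pi\<^sub>M I (\<lambda>_. ?E))" "f \<in> I \<rightarrow> L" "\<And>k. snd (f k) = k" for F f L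
    by (rule nn_integral_PiM_distr_reindex[OF M indep False prob_D])
      (use that in \<open>auto simp: D_def intro: inj_on_inverseI[where g = snd]\<close>)
  have norm_meas: "(\<lambda>x. norm ((\<Sum>k\<in>I. a k *\<^sub>R x k) - T)) \<in> borel_measurable (Pi\<^sub>M I (\<lambda>_. ?E))" for a T
    by (intro measurable_compose[OF _ measurable_operator_norm] operator_sum_measurable
        measurable_component_singleton)
  define G where "G a z = ennreal (exp (t * norm ((\<Sum>k\<in>I. a k *\<^sub>R z (True, k)) - (\<Sum>k\<in>I. a k *\<^sub>R z (False, k)))))"
    for a :: "'i \<Rightarrow> real" and z :: "bool \<times> 'i \<Rightarrow> ('a \<Rightarrow>\<^sub>L 'b)"
  have G_meas: "G a \<in> borel_measurable Q" for a
  proof -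
    have "(\<lambda>z. norm ((\<Sum>j\<in>K True \<union> K False. (if fst j then a (snd j) else - a (snd j)) *\<^sub>R z j) - 0))
        \<in> borel_measurable Q"
      unfolding Q_def by (intro measurable_compose[OF _ measurable_operator_norm] operator_sum_measurable comp)
    moreover have "(\<Sum>j\<in>K True \<union> K False. (if fst j then a (snd j) else - a (snd j)) *\<^sub>R z j)
        = (\<Sum>k\<in>I. a k *\<^sub>R z (True, k)) - (\<Sum>k\<in>I. a k *\<^sub>R z (False, k))" for z :: "bool \<times> 'i \<Rightarrow> ('a \<Rightarrow>\<^sub>L 'b)"
    proof -
      have "(\<Sum>j\<in>K b. (if fst j then a (snd j) else - a (snd j)) *\<^sub>R z j)
          = (\<Sum>k\<in>I. (if b then a k else - a k) *\<^sub>R z (b, k))" for b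
        unfolding K_def
        by (rule sum.reindex_bij_witness[of _ "\<lambda>k. (b, k)" snd]) auto
      then show ?thesis
        using K by (simp add: sum.union_disjoint sum_negf)
    qed
    ultimately show ?thesis by (simp add: G_def[abs_def])
  qed
  have "(\<integral>\<^sup>+\<omega>. ennreal (exp (t * norm (\<Sum>k\<in>I. A k \<omega> - op_expectation M (A k)))) \<partial>M)
      = (\<integral>\<^sup>+\<omega>. ennreal (exp (t * norm ((\<Sum>k\<in>I. 1 *\<^sub>R (\<lambda>k\<in>I. A k \<omega>) k) - c))) \<partial>M)"
    by (simp add: c_def sum_subtractf)
  also have "\<dots> = (\<integral>\<^sup>+x. ennreal (exp (t * norm ((\<Sum>k\<in>I. 1 *\<^sub>R (\<lambda>k\<in>I. x (True, k)) k) - c))) \<partial>Pi\<^sub>M (K True) D)"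
    using norm_meas[of "\<lambda>_. 1" c]
    by (intro reindex[of "\<lambda>x. ennreal (exp (t * norm ((\<Sum>k\<in>I. 1 *\<^sub>R x k) - c)))" "\<lambda>k. (True, k)", symmetric])
      (auto simp: K_def)
  \<comment> \<open>With the first copy \<open>x\<close> held fixed, the expectation is replaced by
    the second copy through Jensen's inequality.\<close>
  also have "\<dots> \<le> (\<integral>\<^sup>+x. \<integral>\<^sup>+y. G (\<lambda>_. 1) (merge (K True) (K False) (x, y)) \<partial>Pi\<^sub>M (K False) D \<partial>Pi\<^sub>M (K True) D)"
  proof (rule nn_integral_mono)
    fix x :: "bool \<times> 'i \<Rightarrow> ('a \<Rightarrow>\<^sub>L 'b)"
    let ?P = "Pi\<^sub>M (K False) D"
    have P: "prob_space ?P" by (intro prob_space_PiM prob_D)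
    have meas: "(\<lambda>y. y (False, k)) \<in> ?P \<rightarrow>\<^sub>M ?E" if "k \<in> I" for k
      using that by (intro comp) (auto simp: K_def)
    have ae: "AE y in ?P. norm (y (False, k)) \<le> C" if "k \<in> I" for k
    proof (rule AE_PiM_component)
      show "(False, k) \<in> K False" using that by (simp add: K_def)
      show "AE x in D (False, k). norm x \<le> C"
      proof -
        have "{T \<in> space ?E. norm T \<le> C} \<in> sets ?E"
          by measurable
        with bounded[OF that] A[OF that] show ?thesis
          unfolding D_eq[OF that] by (simp add: AE_distr_iff)
      qed
    qed (rule prob_D)
    have exp_eq: "op_expectation ?P (\<lambda>y. y (False, k)) = op_expectation M (A k)" if k: "k \<in> I" for k
    proof -
      have "(\<integral>y. blinfun_apply (y (False, k)) x \<partial>?P) = (\<integral>\<omega>. blinfun_apply (A k \<omega>) x \<partial>M)" for x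
      proof -
        have "(\<integral>y. blinfun_apply (y (False, k)) x \<partial>?P)
            = (\<integral>T. blinfun_apply T x \<partial>distr ?P (D (False, k)) (\<lambda>y. y (False, k)))"
          using k by (intro integral_distr[symmetric] measurable_component_singleton)
            (auto simp: K_def measurable_cong_sets[OF sets_D refl])
        also have "distr ?P (D (False, k)) (\<lambda>y. y (False, k)) = distr M ?E (A k)"
          using k by (subst distr_PiM_component) (auto simp: K_def D_eq prob_D)
        also have "(\<integral>T. blinfun_apply T x \<partial>\<dots>) = (\<integral>\<omega>. blinfun_apply (A k \<omega>) x \<partial>M)"
          by (intro integral_distr A[OF k]) measurable
        finally show ?thesis .
      qed
      then show ?thesis by (simp add: op_expectation_def)
    qed
    have "ennreal (exp (t * norm ((\<Sum>k\<in>I. x (True, k)) - (\<Sum>k\<in>I. op_expectation ?P (\<lambda>y. y (False, k))))))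
        \<le> (\<integral>\<^sup>+y. ennreal (exp (t * norm ((\<Sum>k\<in>I. x (True, k)) - (\<Sum>k\<in>I. y (False, k))))) \<partial>?P)"
      by (rule exp_norm_diff_expectation_le[OF P meas ae I t])
    moreover have "G (\<lambda>_. 1) (merge (K True) (K False) (x, y))
        = ennreal (exp (t * norm ((\<Sum>k\<in>I. x (True, k)) - (\<Sum>k\<in>I. y (False, k)))))" for y
      by (simp add: G_def merge_def K_def)
    ultimately show "ennreal (exp (t * norm ((\<Sum>k\<in>I. 1 *\<^sub>R (\<lambda>k\<in>I. x (True, k)) k) - c)))
        \<le> (\<integral>\<^sup>+y. G (\<lambda>_. 1) (merge (K True) (K False) (x, y)) \<partial>?P)"
      by (simp add: c_def exp_eq)
  qed
  also have "\<dots> = (\<integral>\<^sup>+z. G (\<lambda>_. 1) z \<partial>Q)"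
    unfolding Q_def using K G_meas[unfolded Q_def] by (intro D.product_nn_integral_fold[symmetric]) auto
  also have "\<dots> = (\<integral>\<^sup>+z. G s z \<partial>Q)"
  proof -
    define f where "f j = (if s (snd j) = 1 then fst j else \<not> fst j, snd j)" for j :: "bool \<times> 'i"
    let ?L = "K True \<union> K False"
    have f: "inj_on f ?L" "f \<in> ?L \<rightarrow> ?L"
      by (auto simp: f_def K_def inj_on_def split: if_splits)
    \<comment> \<open>The exchange preserves the product measure because the law depends only on the
      operator index, not on the copy.\<close>
    have Df: "D (f j) = D j" for j
      by (simp add: D_def f_def)
    have "(\<integral>\<^sup>+z. G s z \<partial>Q) = (\<integral>\<^sup>+z. G s z \<partial>distr Q Q (\<lambda>z. \<lambda>j\<in>?L. z (f j)))"
      using distr_PiM_reindex[of ?L D f ?L] f prob_D by (simp add: Q_def Df)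
    also have "\<dots> = (\<integral>\<^sup>+z. G s (\<lambda>j\<in>?L. z (f j)) \<partial>Q)"
    proof (rule nn_integral_distr)
      have "(\<lambda>z. \<lambda>j\<in>?L. z (f j)) \<in> Pi\<^sub>M ?L D \<rightarrow>\<^sub>M Pi\<^sub>M ?L (\<lambda>j. D (f j))"
        using f(2) by (intro measurable_restrict measurable_component_singleton) auto
      then show "(\<lambda>z. \<lambda>j\<in>?L. z (f j)) \<in> Q \<rightarrow>\<^sub>M Q"
        by (simp add: Q_def Df)
    qed (simp add: G_meas)
    also have "(\<lambda>z. G s (\<lambda>j\<in>?L. z (f j))) = G (\<lambda>_. 1)"
    proof
      fix z :: "bool \<times> 'i \<Rightarrow> ('a \<Rightarrow>\<^sub>L 'b)"
      have "(\<Sum>k\<in>I. s k *\<^sub>R (\<lambda>j\<in>?L. z (f j)) (True, k)) - (\<Sum>k\<in>I. s k *\<^sub>R (\<lambda>j\<in>?L. z (f j)) (False, k))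
          = (\<Sum>k\<in>I. 1 *\<^sub>R z (True, k)) - (\<Sum>k\<in>I. 1 *\<^sub>R z (False, k))"
        unfolding sum_subtractf[symmetric]
        by (rule sum.cong) (use s in \<open>force simp: f_def K_def\<close>)+
      then show "G s (\<lambda>j\<in>?L. z (f j)) = G (\<lambda>_. 1) z"
        unfolding G_def by (simp only:)
    qed
    finally show ?thesis ..
  qed
  also have "\<dots> \<le> (\<integral>\<^sup>+z. ennreal (exp (2 * t * norm (\<Sum>k\<in>I. s k *\<^sub>R z (True, k))) / 2)
        + ennreal (exp (2 * t * norm (\<Sum>k\<in>I. s k *\<^sub>R z (False, k))) / 2) \<partial>Q)"
    unfolding G_def
    by (subst ennreal_plus[symmetric])
      (auto intro!: nn_integral_mono ennreal_leI exp_norm_sum_le t simp del: ennreal_plus)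
  also have "\<dots> = (\<integral>\<^sup>+z. ennreal (exp (2 * t * norm (\<Sum>k\<in>I. s k *\<^sub>R z (True, k))) / 2) \<partial>Q)
        + (\<integral>\<^sup>+z. ennreal (exp (2 * t * norm (\<Sum>k\<in>I. s k *\<^sub>R z (False, k))) / 2) \<partial>Q)"
  proof (rule nn_integral_add)
    have "(\<lambda>z. norm ((\<Sum>k\<in>I. s k *\<^sub>R z (b, k)) - 0)) \<in> borel_measurable Q" for b
      unfolding Q_def
      by (intro measurable_compose[OF _ measurable_operator_norm] operator_sum_measurable comp)
        (auto simp: K_def)
    then have m: "(\<lambda>z. norm (\<Sum>k\<in>I. s k *\<^sub>R z (b, k))) \<in> borel_measurable Q" for b
      by simp
    show "(\<lambda>z. ennreal (exp (2 * t * norm (\<Sum>k\<in>I. s k *\<^sub>R z (True, k))) / 2)) \<in> borel_measurable Q"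
      "(\<lambda>z. ennreal (exp (2 * t * norm (\<Sum>k\<in>I. s k *\<^sub>R z (False, k))) / 2)) \<in> borel_measurable Q"
      using m[of True] m[of False] by measurable
  qed
  also have "\<dots> = (\<integral>\<^sup>+\<omega>. ennreal (exp (2 * t * norm (\<Sum>k\<in>I. s k *\<^sub>R A k \<omega>)) / 2) \<partial>M)
      + (\<integral>\<^sup>+\<omega>. ennreal (exp (2 * t * norm (\<Sum>k\<in>I. s k *\<^sub>R A k \<omega>)) / 2) \<partial>M)"
  proof -
    have "(\<integral>\<^sup>+z. ennreal (exp (2 * t * norm (\<Sum>k\<in>I. s k *\<^sub>R z (b, k))) / 2) \<partial>Q)
      = (\<integral>\<^sup>+\<omega>. ennreal (exp (2 * t * norm (\<Sum>k\<in>I. s k *\<^sub>R A k \<omega>)) / 2) \<partial>M)" for b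
      using reindex[of "\<lambda>x. ennreal (exp (2 * t * norm ((\<Sum>k\<in>I. s k *\<^sub>R x k) - 0)) / 2)" "\<lambda>k. (b, k)"
          "K True \<union> K False"] norm_meas[of s 0]
      by (auto simp: K_def Q_def)
    then show ?thesis by simp
  qed
  also have "\<dots> = (\<integral>\<^sup>+\<omega>. ennreal (exp (2 * t * norm (\<Sum>k\<in>I. s k *\<^sub>R A k \<omega>)) / 2)
      + ennreal (exp (2 * t * norm (\<Sum>k\<in>I. s k *\<^sub>R A k \<omega>)) / 2) \<partial>M)"
  proof (rule nn_integral_add[symmetric])
    have "(\<lambda>\<omega>. norm ((\<Sum>k\<in>I. s k *\<^sub>R A k \<omega>) - 0)) \<in> borel_measurable M"
      by (intro measurable_compose[OF _ measurable_operator_norm] operator_sum_measurable A)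
    then show "(\<lambda>\<omega>. ennreal (exp (2 * t * norm (\<Sum>k\<in>I. s k *\<^sub>R A k \<omega>)) / 2)) \<in> borel_measurable M"
      by simp
    then show "(\<lambda>\<omega>. ennreal (exp (2 * t * norm (\<Sum>k\<in>I. s k *\<^sub>R A k \<omega>)) / 2)) \<in> borel_measurable M" .
  qed
  also have "\<dots> = (\<integral>\<^sup>+\<omega>. ennreal (exp (2 * t * norm (\<Sum>k\<in>I. s k *\<^sub>R A k \<omega>))) \<partial>M)"
    by (simp add: ennreal_plus[symmetric] del: ennreal_plus)
  finally show ?thesis .
qed simp

section \<open>Exponential moments and tail bounds\<close>

context prob_space
begin

text \<open>Jensen's inequality for the concave power \<open>r\<close>, proved by the chord bound
  \<open>exp (r x) \<le> 1 - r + r exp x\<close> at \<open>x = W - c\<close>; the normalization by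
  \<open>c\<close> makes the right side average to 1.\<close>

lemma exp_moment_powr_le:
  fixes r c :: real
  assumes W: "integrable M W" "integrable M (\<lambda>\<omega>. exp (W \<omega>))" "integrable M (\<lambda>\<omega>. exp (r * W \<omega>))"
    and r: "0 \<le> r" "r \<le> 1" and c: "expectation (\<lambda>\<omega>. exp (W \<omega>)) = exp c"
  shows "expectation (\<lambda>\<omega>. exp (r * W \<omega>)) \<le> exp (r * c)"
proof -
  have conv: "exp (r * x) \<le> 1 - r + r * exp x" for x :: real
    using convex_onD[OF exp_convex r, of 0 x] by simp
  have "expectation (\<lambda>\<omega>. exp (r * W \<omega>)) \<le> expectation (\<lambda>\<omega>. exp (r * c) * (1 - r) + exp (r * c) * r * exp (- c) * exp (W \<omega>))"
  proof (rule integral_mono)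
    fix \<omega>
    have "exp (r * W \<omega>) = exp (r * c) * exp (r * (W \<omega> - c))"
      by (simp add: exp_add[symmetric] algebra_simps)
    also have "\<dots> \<le> exp (r * c) * (1 - r + r * exp (W \<omega> - c))"
      by (intro mult_left_mono conv) simp
    also have "\<dots> = exp (r * c) * (1 - r) + exp (r * c) * r * exp (- c) * exp (W \<omega>)"
      by (simp add: exp_diff exp_minus field_simps)
    finally show "exp (r * W \<omega>) \<le> exp (r * c) * (1 - r) + exp (r * c) * r * exp (- c) * exp (W \<omega>)" .
  qed (use W in auto)
  also have "\<dots> = exp (r * c) * (1 - r) + exp (r * c) * r * exp (- c) * exp c"
    using W by (simp add: c prob_space)
  also have "\<dots> = exp (r * c)"
    by (simp add: exp_minus field_simps)
  finally show ?thesis .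
qed

lemma exp_moment_tail_le:
  fixes f :: "'a \<Rightarrow> real"
  assumes int: "integrable M (\<lambda>\<omega>. exp (t * f \<omega>))" and t: "t > 0"
    and bound: "expectation (\<lambda>\<omega>. exp (t * f \<omega>)) \<le> c * exp b"
  shows "prob {\<omega> \<in> space M. f \<omega> > s} \<le> c * exp (b - t * s)"
proof -
  have [measurable]: "(\<lambda>\<omega>. exp (t * f \<omega>)) \<in> borel_measurable M"
    using int by simp
  have "prob {\<omega> \<in> space M. f \<omega> > s} \<le> prob {\<omega> \<in> space M. exp (t * f \<omega>) \<ge> exp (t * s)}"
  proof (rule finite_measure_mono)
    show "{\<omega> \<in> space M. exp (t * f \<omega>) \<ge> exp (t * s)} \<in> events"
      by measurable
  qed (use t in auto)
  also have "\<dots> \<le> expectation (\<lambda>\<omega>. exp (t * f \<omega>)) / exp (t * s)"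
    by (rule integral_Markov_inequality_measure[OF int, of "space M"]) auto
  also have "\<dots> \<le> c * exp b / exp (t * s)"
    using bound by (intro divide_right_mono) auto
  finally show ?thesis by (simp add: exp_diff)
qed

end

text \<open>The bounds matter because \<open>op_expectation\<close> goes through
  \<open>Blinfun\<close>: they make it the pointwise Bochner integral, which is additive.\<close>

lemma op_expectation_sum:
  fixes Y :: "'i \<Rightarrow> 'w \<Rightarrow> ('a::{real_normed_vector, second_countable_topology} \<Rightarrow>\<^sub>L 'b::{banach, second_countable_topology})"
  assumes M: "finite_measure M" and Y: "\<And>k. k \<in> I \<Longrightarrow> Y k \<in> M \<rightarrow>\<^sub>M operator_algebra"
    and bounded: "\<And>k. k \<in> I \<Longrightarrow> AE \<omega> in M. norm (Y k \<omega>) \<le> C" and I: "finite I"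
  shows "op_expectation M (\<lambda>\<omega>. \<Sum>k\<in>I. Y k \<omega>) = (\<Sum>k\<in>I. op_expectation M (Y k))"
proof (rule blinfun_eqI)
  interpret finite_measure M by fact
  fix x
  have int: "integrable M (\<lambda>\<omega>. blinfun_apply (Y k \<omega>) x)" if "k \<in> I" for k
  proof (rule integrable_const_bound[of _ "C * norm x"])
    show "AE \<omega> in M. norm (blinfun_apply (Y k \<omega>) x) \<le> C * norm x"
      using bounded[OF that]
      by eventually_elim (meson mult_right_mono norm_blinfun norm_ge_zero order_trans)
    show "(\<lambda>\<omega>. blinfun_apply (Y k \<omega>) x) \<in> borel_measurable M"
      by (rule measurable_compose[OF Y[OF that] measurable_operator_eval])
  qed
  have "AE \<omega> in M. \<forall>k\<in>I. norm (Y k \<omega>) \<le> C"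
    using bounded I by (simp add: AE_finite_all)
  then have sum_bound: "AE \<omega> in M. norm (\<Sum>k\<in>I. Y k \<omega>) \<le> (\<Sum>k\<in>I. C)"
    by eventually_elim (intro sum_norm_le, auto)
  have "(\<lambda>\<omega>. \<Sum>k\<in>I. Y k \<omega>) \<in> M \<rightarrow>\<^sub>M operator_algebra"
    using operator_sum_measurable[of I Y M "\<lambda>_. 1" 0] Y by simp
  from op_expectation_apply[OF M this sum_bound]
  have "blinfun_apply (op_expectation M (\<lambda>\<omega>. \<Sum>k\<in>I. Y k \<omega>)) x
      = (\<integral>\<omega>. (\<Sum>k\<in>I. blinfun_apply (Y k \<omega>) x) \<partial>M)"
    by (simp add: blinfun.sum_left)
  also have "\<dots> = (\<Sum>k\<in>I. \<integral>\<omega>. blinfun_apply (Y k \<omega>) x \<partial>M)"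
    by (intro Bochner_Integration.integral_sum int)
  also have "\<dots> = blinfun_apply (\<Sum>k\<in>I. op_expectation M (Y k)) x"
    by (simp add: blinfun.sum_left op_expectation_apply[OF M Y bounded])
  finally show "blinfun_apply (op_expectation M (\<lambda>\<omega>. \<Sum>k\<in>I. Y k \<omega>)) x
      = blinfun_apply (\<Sum>k\<in>I. op_expectation M (Y k)) x" .
qed

section \<open>Exponential moments of \<open>Y\<close> and \<open>Z\<close>, and the three
  claims\<close>

locale random_operators = prob_space M
  for M :: "'w measure" +
  fixes A :: "'i \<Rightarrow> 'w \<Rightarrow> ('h::{real_inner, banach, second_countable_topology} \<Rightarrow>\<^sub>L 'h)"
    and I :: "'i set" and d :: nat
  assumes finite_index: "finite I"
    and indep: "indep_vars (\<lambda>_. operator_algebra) A I"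
    and nonneg: "\<And>k. k \<in> I \<Longrightarrow> AE \<omega> in M. 0 \<preceq> A k \<omega>"
    and le_id: "\<And>k. k \<in> I \<Longrightarrow> AE \<omega> in M. A k \<omega> \<preceq> id_blinfun"
    and d_pos: "d \<ge> 1"
    and dim_le: "AE \<omega> in M. finite_dim_le (span (\<Union>k\<in>I. range (blinfun_apply (A k \<omega>)))) d"
begin

definition V :: real where "V = norm (\<Sum>k\<in>I. op_expectation M (A k))"
definition Y :: "'w \<Rightarrow> real" where "Y \<omega> = norm (\<Sum>k\<in>I. A k \<omega>)"
definition Z :: "'w \<Rightarrow> real" where "Z \<omega> = norm (\<Sum>k\<in>I. A k \<omega> - op_expectation M (A k))"

lemma V_nonneg: "V \<ge> 0" by (simp add: V_def)

lemma A_measurable: "k \<in> I \<Longrightarrow> A k \<in> M \<rightarrow>\<^sub>M operator_algebra"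
  using indep by (auto simp: indep_vars_def)

lemma norm_A_le: "k \<in> I \<Longrightarrow> AE \<omega> in M. norm (A k \<omega>) \<le> 1"
  using nonneg[of k] le_id[of k] by (auto elim!: eventually_elim2 intro: norm_le_one_if_le_id)

lemma norm_sum_measurable: "(\<lambda>\<omega>. norm ((\<Sum>k\<in>I. a k *\<^sub>R A k \<omega>) - T)) \<in> borel_measurable M"
  by (intro measurable_compose[OF _ measurable_operator_norm] operator_sum_measurable A_measurable)

lemma norm_sum_bounded:
  "AE \<omega> in M. norm ((\<Sum>k\<in>I. a k *\<^sub>R A k \<omega>) - T) \<le> (\<Sum>k\<in>I. \<bar>a k\<bar>) + norm T"
proof -
  have "AE \<omega> in M. \<forall>k\<in>I. norm (A k \<omega>) \<le> 1"
    using norm_A_le finite_index by (simp add: AE_finite_all)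
  then show ?thesis
  proof eventually_elim
    fix \<omega> assume *: "\<forall>k\<in>I. norm (A k \<omega>) \<le> 1"
    have "norm ((\<Sum>k\<in>I. a k *\<^sub>R A k \<omega>) - T) \<le> norm (\<Sum>k\<in>I. a k *\<^sub>R A k \<omega>) + norm T"
      by (rule norm_triangle_ineq4)
    also have "norm (\<Sum>k\<in>I. a k *\<^sub>R A k \<omega>) \<le> (\<Sum>k\<in>I. \<bar>a k\<bar>)"
      using * by (intro sum_norm_le) (auto intro: mult_left_le)
    finally show "norm ((\<Sum>k\<in>I. a k *\<^sub>R A k \<omega>) - T) \<le> (\<Sum>k\<in>I. \<bar>a k\<bar>) + norm T"
      by simp
  qed
qed

lemma integrable_norm_sum: "integrable M (\<lambda>\<omega>. norm ((\<Sum>k\<in>I. a k *\<^sub>R A k \<omega>) - T))"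
  using norm_sum_bounded[of a T] norm_sum_measurable[of a T] by (intro integrable_const_bound) auto

lemma integrable_exp_norm_sum:
  assumes "t \<ge> 0"
  shows "integrable M (\<lambda>\<omega>. exp (t * norm ((\<Sum>k\<in>I. a k *\<^sub>R A k \<omega>) - T)))"
proof (rule integrable_const_bound)
  show "AE \<omega> in M. norm (exp (t * norm ((\<Sum>k\<in>I. a k *\<^sub>R A k \<omega>) - T)))
      \<le> exp (t * ((\<Sum>k\<in>I. \<bar>a k\<bar>) + norm T))"
    using norm_sum_bounded[of a T] by eventually_elim (simp add: assms mult_left_mono)
qed (use norm_sum_measurable[of a T] in measurable)

lemma integrable_Y: "integrable M Y"
  using integrable_norm_sum[of "\<lambda>_. 1" 0] by (simp add: Y_def[abs_def])

lemma integrable_exp_Y: "t \<ge> 0 \<Longrightarrow> integrable M (\<lambda>\<omega>. exp (t * Y \<omega>))"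
  using integrable_exp_norm_sum[of t "\<lambda>_. 1" 0] by (simp add: Y_def)

lemma integrable_Z: "integrable M Z"
  using integrable_norm_sum[of "\<lambda>_. 1" "\<Sum>k\<in>I. op_expectation M (A k)"]
  by (simp add: Z_def[abs_def] sum_subtractf)

lemma integrable_exp_Z: "t \<ge> 0 \<Longrightarrow> integrable M (\<lambda>\<omega>. exp (t * Z \<omega>))"
  using integrable_exp_norm_sum[of t "\<lambda>_. 1" "\<Sum>k\<in>I. op_expectation M (A k)"]
  by (simp add: Z_def sum_subtractf)

lemma Y_le: "Y \<omega> \<le> V + Z \<omega>"
proof -
  have "(\<Sum>k\<in>I. A k \<omega>) = (\<Sum>k\<in>I. op_expectation M (A k)) + (\<Sum>k\<in>I. A k \<omega> - op_expectation M (A k))"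
    by (simp add: sum_subtractf)
  then show ?thesis
    unfolding Y_def V_def Z_def by (metis norm_triangle_ineq)
qed

text \<open>Symmetrization holds for every fixed choice of signs, hence for their average. That
  average is taken inside the expectation, where the bound for one realization applies with
  parameter \<open>2 * t\<close>, giving the exponent \<open>(2t)^2 Y / 2\<close>.\<close>

lemma exp_Z_le_exp_Y:
  assumes t: "t \<ge> 0"
  shows "expectation (\<lambda>\<omega>. exp (t * Z \<omega>)) \<le> 2 * real d * expectation (\<lambda>\<omega>. exp (2 * t\<^sup>2 * Y \<omega>))"
proof -
  define S where "S J \<omega> = norm (\<Sum>k\<in>I. rademacher J k *\<^sub>R A k \<omega>)" for J \<omega>
  have int_S: "integrable M (\<lambda>\<omega>. exp (2 * t * S J \<omega>))" for J
    using integrable_exp_norm_sum[of "2 * t" "rademacher J" 0] t by (simp add: S_def)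
  have sym: "expectation (\<lambda>\<omega>. exp (t * Z \<omega>)) \<le> expectation (\<lambda>\<omega>. exp (2 * t * S J \<omega>))" for J
  proof -
    have "(\<integral>\<^sup>+\<omega>. ennreal (exp (t * Z \<omega>)) \<partial>M) \<le> (\<integral>\<^sup>+\<omega>. ennreal (exp (2 * t * S J \<omega>)) \<partial>M)"
      unfolding Z_def S_def
      by (rule symmetrization[OF prob_space_axioms indep norm_A_le finite_index t])
        (auto simp: rademacher_def)
    moreover have "(\<integral>\<^sup>+\<omega>. ennreal (exp (t * Z \<omega>)) \<partial>M) = ennreal (expectation (\<lambda>\<omega>. exp (t * Z \<omega>)))"
      by (rule nn_integral_eq_integral) (simp_all add: integrable_exp_Z t)
    moreover have "(\<integral>\<^sup>+\<omega>. ennreal (exp (2 * t * S J \<omega>)) \<partial>M) = ennreal (expectation (\<lambda>\<omega>. exp (2 * t * S J \<omega>)))"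
      by (rule nn_integral_eq_integral) (simp_all add: int_S)
    ultimately show ?thesis
      by (simp add: ennreal_le_iff)
  qed
  have ae: "AE \<omega> in M. (\<forall>k\<in>I. 0 \<preceq> A k \<omega>) \<and> (\<forall>k\<in>I. A k \<omega> \<preceq> id_blinfun)"
    using nonneg le_id finite_index by (simp add: AE_finite_all)
  have "2 ^ card I * expectation (\<lambda>\<omega>. exp (t * Z \<omega>)) = (\<Sum>J\<in>Pow I. expectation (\<lambda>\<omega>. exp (t * Z \<omega>)))"
    using finite_index by (simp add: card_Pow)
  also have "\<dots> \<le> (\<Sum>J\<in>Pow I. expectation (\<lambda>\<omega>. exp (2 * t * S J \<omega>)))"
    by (intro sum_mono sym)
  also have "\<dots> = expectation (\<lambda>\<omega>. \<Sum>J\<in>Pow I. exp (2 * t * S J \<omega>))"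
    by (intro Bochner_Integration.integral_sum[symmetric] int_S)
  also have "\<dots> \<le> expectation (\<lambda>\<omega>. 2 ^ card I * (2 * real d * exp (2 * t\<^sup>2 * Y \<omega>)))"
  proof (rule integral_mono_AE)
    show "AE \<omega> in M. (\<Sum>J\<in>Pow I. exp (2 * t * S J \<omega>)) \<le> 2 ^ card I * (2 * real d * exp (2 * t\<^sup>2 * Y \<omega>))"
      using ae dim_le
    proof eventually_elim
      fix \<omega>
      assume "(\<forall>k\<in>I. 0 \<preceq> A k \<omega>) \<and> (\<forall>k\<in>I. A k \<omega> \<preceq> id_blinfun)"
        and "finite_dim_le (span (\<Union>k\<in>I. range (blinfun_apply (A k \<omega>)))) d"
      then show "(\<Sum>J\<in>Pow I. exp (2 * t * S J \<omega>)) \<le> 2 ^ card I * (2 * real d * exp (2 * t\<^sup>2 * Y \<omega>))"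
        using rademacher_exp_norm_le[of I "\<lambda>k. A k \<omega>" d "2 * t"] finite_index d_pos
        by (simp add: S_def Y_def power_mult_distrib mult.assoc)
    qed
  qed (simp_all add: int_S integrable_exp_Y)
  also have "\<dots> = 2 ^ card I * (2 * real d * expectation (\<lambda>\<omega>. exp (2 * t\<^sup>2 * Y \<omega>)))"
    by simp
  finally show ?thesis
    by simp
qed

text \<open>The exponential moment of \<open>Y \<le> V + Z\<close> of order \<open>2t\<^sup>2\<close> is again controlled by the one
  of \<open>Z\<close> of order \<open>t\<close>, to the power \<open>2t < 1\<close>; solving for the latter turns the factor
  \<open>2d\<close> into \<open>(2d)\<^bsup>1/(1-2t)\<^esup> \<le> 4d\<^sup>2\<close>.\<close>

lemma exp_Z_le:
  assumes t: "0 < t" "t \<le> 1/4"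
  shows "expectation (\<lambda>\<omega>. exp (t * Z \<omega>)) \<le> 4 * (real d)\<^sup>2 * exp (2 * t\<^sup>2 * V / (1 - 2 * t))"
proof -
  define c where "c = ln (expectation (\<lambda>\<omega>. exp (t * Z \<omega>)))"
  have "1 \<le> expectation (\<lambda>\<omega>. exp (t * Z \<omega>))"
  proof -
    have "expectation (\<lambda>\<omega>. 1) \<le> expectation (\<lambda>\<omega>. exp (t * Z \<omega>))"
      using t by (intro integral_mono integrable_exp_Z) (auto simp: Z_def)
    then show ?thesis by (simp add: prob_space)
  qed
  then have c: "expectation (\<lambda>\<omega>. exp (t * Z \<omega>)) = exp c"
    by (simp add: c_def)
  have "expectation (\<lambda>\<omega>. exp (2 * t\<^sup>2 * Y \<omega>)) \<le> expectation (\<lambda>\<omega>. exp (2 * t\<^sup>2 * V) * exp (2 * t\<^sup>2 * Z \<omega>))"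
    by (intro integral_mono integrable_exp_Y integrable_mult_right integrable_exp_Z)
      (simp_all add: exp_add[symmetric] distrib_left[symmetric] mult_left_mono Y_le)
  also have "\<dots> = exp (2 * t\<^sup>2 * V) * expectation (\<lambda>\<omega>. exp (2 * t * (t * Z \<omega>)))"
    by (simp add: power2_eq_square mult_ac)
  \<comment> \<open>The moment comparison with exponent \<open>2 * t\<close> and variable
    \<open>t * Z\<close>, so that the logarithm \<open>c\<close> of the unknown moment reappears on
    the right.\<close>
  also have "\<dots> \<le> exp (2 * t\<^sup>2 * V) * exp (2 * t * c)"
  proof (intro mult_left_mono exp_moment_powr_le[where c = c])
    show "integrable M (\<lambda>\<omega>. exp (2 * t * (t * Z \<omega>)))"
      using integrable_exp_Z[of "2 * t * t"] t by (simp add: mult.assoc)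
  qed (use t c integrable_Z integrable_exp_Z in auto)
  finally have "exp c \<le> 2 * real d * (exp (2 * t\<^sup>2 * V) * exp (2 * t * c))"
    using exp_Z_le_exp_Y[of t] t d_pos unfolding c by (smt (verit) mult_left_mono of_nat_0_le_iff)
  also have "\<dots> = exp (ln (2 * real d) + (2 * t\<^sup>2 * V + 2 * t * c))"
    using d_pos by (simp add: exp_add)
  finally have "c * (1 - 2 * t) \<le> ln (2 * real d) + 2 * t\<^sup>2 * V"
    by (simp add: algebra_simps)
  moreover have "1 - 2 * t > 0" "1 / (1 - 2 * t) \<le> 2" using t by (simp_all add: field_simps)
  ultimately have "c \<le> ln (2 * real d) * (1 / (1 - 2 * t)) + 2 * t\<^sup>2 * V / (1 - 2 * t)"
    by (simp add: pos_le_divide_eq add_divide_distrib[symmetric])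
  also have "\<dots> \<le> ln (2 * real d) * 2 + 2 * t\<^sup>2 * V / (1 - 2 * t)"
    using d_pos \<open>1 / (1 - 2 * t) \<le> 2\<close> by (intro add_right_mono mult_left_mono) auto
  finally have "exp c \<le> exp (ln (2 * real d) + ln (2 * real d) + 2 * t\<^sup>2 * V / (1 - 2 * t))"
    by simp
  also have "\<dots> = 4 * (real d)\<^sup>2 * exp (2 * t\<^sup>2 * V / (1 - 2 * t))"
    using d_pos by (simp only: exp_add) (simp add: power2_eq_square)
  finally show ?thesis by (simp add: c)
qed

text \<open>From \<open>Y \<le> V + Z\<close>; the additional \<open>t * V\<close> combines with the
  exponent for \<open>Z\<close> into a single fraction.\<close>

lemma exp_Y_le:
  assumes t: "0 < t" "t \<le> 1/4"
  shows "expectation (\<lambda>\<omega>. exp (t * Y \<omega>)) \<le> 4 * (real d)\<^sup>2 * exp (t * V / (1 - 2 * t))"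
proof -
  have "expectation (\<lambda>\<omega>. exp (t * Y \<omega>)) \<le> expectation (\<lambda>\<omega>. exp (t * V) * exp (t * Z \<omega>))"
    using t by (intro integral_mono integrable_exp_Y integrable_mult_right integrable_exp_Z)
      (simp_all add: exp_add[symmetric] distrib_left[symmetric] mult_left_mono Y_le)
  also have "\<dots> = exp (t * V) * expectation (\<lambda>\<omega>. exp (t * Z \<omega>))"
    by simp
  also have "\<dots> \<le> exp (t * V) * (4 * (real d)\<^sup>2 * exp (2 * t\<^sup>2 * V / (1 - 2 * t)))"
    by (intro mult_left_mono exp_Z_le t) simp
  also have "\<dots> = 4 * (real d)\<^sup>2 * exp (t * V + 2 * t\<^sup>2 * V / (1 - 2 * t))"
    by (simp add: exp_add)
  also have "t * V + 2 * t\<^sup>2 * V / (1 - 2 * t) = t * V / (1 - 2 * t)"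
    using t by (simp add: field_simps power2_eq_square)
  finally show ?thesis .
qed

text \<open>With \<open>t = s/(4V + 4s)\<close> the Chernoff exponent \<open>2t\<^sup>2V/(1 - 2t) - ts\<close> equals
  \<open>-s\<^sup>2/(8V + 4s)\<close>.\<close>

lemma prob_Z_gt_le:
  assumes s: "s > 0"
  shows "prob {\<omega> \<in> space M. Z \<omega> > s} \<le> 4 * (real d)\<^sup>2 * exp (- s\<^sup>2 / (9 * V + 6 * s))"
proof -
  define t where "t = s / (4 * (V + s))"
  have pos: "V + s > 0" "2 * V + s > 0" using s V_nonneg by simp_all
  have t: "0 < t" "t \<le> 1/4"
    using s V_nonneg pos by (simp_all add: t_def field_simps)
  have one_minus: "1 - 2 * t = (2 * V + s) / (2 * (V + s))"
    using pos by (simp add: t_def field_simps)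
  have "2 * t\<^sup>2 * V / (1 - 2 * t) - t * s = s\<^sup>2 / (4 * (V + s)) * (V / (2 * V + s) - 1)"
    unfolding one_minus using pos by (simp add: t_def divide_simps power2_eq_square) (simp add: algebra_simps)
  also have "V / (2 * V + s) - 1 = - (V + s) / (2 * V + s)"
    using pos by (simp add: field_simps)
  also have "s\<^sup>2 / (4 * (V + s)) * (- (V + s) / (2 * V + s)) = - (s\<^sup>2 / (4 * (2 * V + s)))"
  proof -
    have "x / (4 * a) * (- a / b) = - (x / (4 * b))" if "a > 0" for x a b :: real
      using that by simp
    from this[OF pos(1)] show ?thesis .
  qed
  \<comment> \<open>The denominator \<open>8V + 4s\<close> is enlarged to the stated one.\<close>
  also have "\<dots> \<le> - (s\<^sup>2 / (9 * V + 6 * s))"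
    using s V_nonneg by (intro le_imp_neg_le divide_left_mono) auto
  finally have exponent: "2 * t\<^sup>2 * V / (1 - 2 * t) - t * s \<le> - s\<^sup>2 / (9 * V + 6 * s)"
    by simp
  have "prob {\<omega> \<in> space M. Z \<omega> > s} \<le> 4 * (real d)\<^sup>2 * exp (2 * t\<^sup>2 * V / (1 - 2 * t) - t * s)"
    using t by (intro exp_moment_tail_le integrable_exp_Z exp_Z_le) auto
  also have "\<dots> \<le> 4 * (real d)\<^sup>2 * exp (- s\<^sup>2 / (9 * V + 6 * s))"
    using exponent by (intro mult_left_mono) auto
  finally show ?thesis .
qed

text \<open>The choice of \<open>t\<close> gives
  \<open>1 - 2t = 1 - 1/(2q) \<ge> 1 - 1/q = 1/p\<close>, so the exponent in \<open>exp_Y_le\<close>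
  is absorbed by \<open>p * V\<close>.\<close>

lemma conjugate_exponent_bound:
  assumes pq: "p > 1" "q > 1" "1 / p + 1 / q = 1"
  defines "t \<equiv> 1 / (4 * q)"
  shows "0 < t" "t \<le> 1/4" "t * V / (1 - 2 * t) \<le> t * (p * V)"
proof -
  show t: "0 < t" "t \<le> 1/4" using pq by (simp_all add: t_def field_simps)
  have "1 / p \<le> 1 - 2 * t"
    using pq by (simp add: t_def field_simps)
  then have "1 / (1 - 2 * t) \<le> p"
    using pq t by (simp add: field_simps)
  then have "t * V * (1 / (1 - 2 * t)) \<le> t * V * p"
    using t V_nonneg by (intro mult_left_mono) auto
  then show "t * V / (1 - 2 * t) \<le> t * (p * V)"
    by (simp add: mult_ac)
qed

lemma prob_Y_gt_le:
  assumes s: "s \<ge> 0" and pq: "p > 1" "q > 1" "1 / p + 1 / q = 1"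
  shows "prob {\<omega> \<in> space M. Y \<omega> > p * V + s} \<le> 4 * (real d)\<^sup>2 * exp (- s / (6 * q))"
proof -
  define t where "t = 1 / (4 * q)"
  note t = conjugate_exponent_bound[OF pq, folded t_def]
  have "prob {\<omega> \<in> space M. Y \<omega> > p * V + s}
      \<le> 4 * (real d)\<^sup>2 * exp (t * V / (1 - 2 * t) - t * (p * V + s))"
    using t by (intro exp_moment_tail_le integrable_exp_Y exp_Y_le) auto
  also have "t * V / (1 - 2 * t) - t * (p * V + s) \<le> - (t * s)"
    using t(3) by (simp add: distrib_left)
  \<comment> \<open>The Chernoff exponent is \<open>- s / (4q)\<close>; the constant 6 is a
    relaxation.\<close>
  also have "- (t * s) \<le> - s / (6 * q)"
    using s pq by (simp add: t_def divide_simps mult_left_mono)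
  finally show ?thesis by (simp add: mult_left_mono)
qed

text \<open>Jensen's inequality bounds \<open>t\<close> times the mean by the logarithm of the
  exponential moment; dividing by \<open>t = 1/(4q)\<close> gives the factor
  \<open>4 * q\<close>.\<close>

lemma expectation_Y_le:
  assumes pq: "p > 1" "q > 1" "1 / p + 1 / q = 1"
  shows "expectation Y \<le> p * V + 4 * q * ln (4 * (real d)\<^sup>2)"
proof -
  define t where "t = 1 / (4 * q)"
  note t = conjugate_exponent_bound[OF pq, folded t_def]
  have "exp (t * expectation Y) = exp (expectation (\<lambda>\<omega>. t * Y \<omega>))"
    by simp
  also have "\<dots> \<le> expectation (\<lambda>\<omega>. exp (t * Y \<omega>))"
    using integrable_Y integrable_exp_Y t
    by (intro jensens_inequality[where I = UNIV]) (auto simp: exp_convex)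
  also have "\<dots> \<le> 4 * (real d)\<^sup>2 * exp (t * V / (1 - 2 * t))"
    by (rule exp_Y_le[OF t(1,2)])
  also have "\<dots> = exp (ln (4 * (real d)\<^sup>2) + t * V / (1 - 2 * t))"
    using d_pos by (simp add: exp_add)
  finally have "t * expectation Y \<le> ln (4 * (real d)\<^sup>2) + t * (p * V)"
    using t(3) by simp
  then show ?thesis
    using pq by (simp add: t_def field_simps)
qed

text \<open>Over conjugate exponents the minimum of \<open>p V + q b\<close> is
  \<open>(sqrt V + sqrt b)^2\<close> when \<open>V\<close> and \<open>b\<close> are positive, so it
  remains to insert the optimal pair.\<close>

lemma sqrt_expectation_Y_le:
  "sqrt (expectation Y) \<le> sqrt V + sqrt (6 * (ln (4 * (real d)\<^sup>2) + 1))"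
proof -
  define L where "L = ln (4 * (real d)\<^sup>2)"
  define b where "b = 6 * (L + 1)"
  have "1 \<le> (real d)\<^sup>2" using d_pos by simp
  then have L: "L \<ge> 0" by (simp add: L_def)
  then have b: "b > 0" "4 * L \<le> b" "6 * L \<le> b" by (simp_all add: b_def)
  show ?thesis
  proof (cases "V = 0")
    case True
    \<comment> \<open>For \<open>V = 0\<close> the optimal \<open>p\<close> is infinite. The value
      \<open>q = 3/2\<close> already makes \<open>4 * q\<close> equal to 6.\<close>
    have "expectation Y \<le> b"
      using expectation_Y_le[of 3 "3/2"] True b by (simp add: L_def)
    then show ?thesis
      using True by (simp add: L_def b_def)
  next
    case False
    with V_nonneg have V: "V > 0" by simp
    define u v where "u = sqrt V" and "v = sqrt b"
    have uv: "u > 0" "v > 0" "V = u * u" "b = v * v"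
      using V b by (simp_all add: u_def v_def)
    \<comment> \<open>The minimizing pair, for which \<open>p V = (u + v) u\<close> and
      \<open>q b = (u + v) v\<close>.\<close>
    define p q where "p = (u + v) / u" and "q = (u + v) / v"
    have pq: "p > 1" "q > 1" "1 / p + 1 / q = 1"
      using uv by (simp_all add: p_def q_def add_divide_distrib[symmetric])
    have "expectation Y \<le> p * V + q * (4 * L)"
      using expectation_Y_le[OF pq] by (simp add: L_def mult_ac)
    also have "\<dots> \<le> p * V + q * b"
      using b pq by (intro add_left_mono mult_left_mono) auto
    also have "\<dots> = (u + v)\<^sup>2"
    proof -
      have "p * V = (u + v) * u" "q * b = (u + v) * v"
        using uv by (simp_all add: p_def q_def)
      then show ?thesis by (simp add: power2_eq_square distrib_left)
    qed
    finally have "sqrt (expectation Y) \<le> u + v"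
      using uv by (intro real_le_lsqrt) auto
    then show ?thesis by (simp add: u_def v_def b_def L_def)
  qed
qed

end

theorem theorem8:
  fixes M :: "'w measure"
    and A :: "nat \<Rightarrow> 'w \<Rightarrow> ('h::{real_inner, banach, second_countable_topology} \<Rightarrow>\<^sub>L 'h)"
    and N d :: nat
  assumes "prob_space M"
    and "prob_space.indep_vars M (\<lambda>_. operator_algebra) A {1..N}"
    and "\<And>k. k \<in> {1..N} \<Longrightarrow>
           AE \<omega> in M. self_adjoint (A k \<omega>) \<and> 0 \<preceq> A k \<omega> \<and> A k \<omega> \<preceq> id_blinfun"
    and "d \<ge> 1"
    and "AE \<omega> in M. finite_dim_le (span (\<Union>k\<in>{1..N}. range (blinfun_apply (A k \<omega>)))) d"
  shows
    "(\<forall>s>0. measure M {\<omega> \<in> space M. norm (\<Sum>k=1..N. A k \<omega> - op_expectation M (A k)) > s}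
        \<le> 4 * (real d)\<^sup>2 * exp (- s\<^sup>2 / (9 * norm (\<Sum>k=1..N. op_expectation M (A k)) + 6 * s)))
     \<and>
     (\<forall>s\<ge>0. \<forall>p q. p > 1 \<and> q > 1 \<and> 1 / p + 1 / q = 1 \<longrightarrow>
        measure M {\<omega> \<in> space M. norm (\<Sum>k=1..N. A k \<omega>)
            > p * norm (op_expectation M (\<lambda>\<omega>. \<Sum>k=1..N. A k \<omega>)) + s}
        \<le> 4 * (real d)\<^sup>2 * exp (- s / (6 * q)))
     \<and>
     sqrt (\<integral>\<omega>. norm (\<Sum>k=1..N. A k \<omega>) \<partial>M)
       \<le> sqrt (norm (op_expectation M (\<lambda>\<omega>. \<Sum>k=1..N. A k \<omega>)))
          + sqrt (6 * (ln (4 * (real d)\<^sup>2) + 1))"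
proof -
  have "random_operators M A {1..N} d"
  proof (intro random_operators.intro random_operators_axioms.intro)
    show "prob_space.indep_vars M (\<lambda>_. operator_algebra) A {1..N}" by fact
    fix k assume "k \<in> {1..N}"
    from assms(3)[OF this]
    show "AE \<omega> in M. 0 \<preceq> A k \<omega>" "AE \<omega> in M. A k \<omega> \<preceq> id_blinfun"
      by (auto elim: eventually_mono)
  qed (use assms in auto)
  then interpret random_operators M A "{1..N}" d .
  have sum: "op_expectation M (\<lambda>\<omega>. \<Sum>k=1..N. A k \<omega>) = (\<Sum>k=1..N. op_expectation M (A k))"
    by (rule op_expectation_sum[OF finite_measure_axioms A_measurable norm_A_le]) auto
  show ?thesis
    unfolding sum
    using prob_Z_gt_le prob_Y_gt_le sqrt_expectation_Y_le
    unfolding V_def Y_def[abs_def] Z_def[abs_def] by blast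
qed

end
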